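(* Let $A,B\in\mathrm{SL}_2\mathbb{Z}_{\ge0}$ be noncommuting and such that the pair $A,B$ is well oriented, and assume $\mathrm{tr}(A)<\mathrm{tr}(B)$ and $\mathrm{tr}(AB)>\mathrm{tr}(B^2)$. If $\mathrm{tr}((AB)^3)>\mathrm{tr}((AB^2)^2)$, then $ab$ is the only optimal word; otherwise $ab^2$ is the only optimal word.
   Context: $\mathrm{SL}_2\mathbb{Z}_{\ge0}$ denotes the $2\times2$ matrices with nonnegative integer entries and determinant $1$. Fixed points are taken for the Möbius action on $\partial\mathcal{H}=\mathbb{P}^1\mathbb{R}$; $\alpha^\pm$ ($\beta^\pm$) are the attracting/repelling fixed points of $A$ ($B$), equal to the unique fixed point if parabolic. With $\partial\mathcal{H}$ cyclically ordered and $[\alpha,\beta]$ the closed counterclockwise interval from $\alpha$ to $\beta$, let $I^+=\{\alpha^+\}$ if $\alpha^+=\beta^+$, and otherwise the one of $[\alpha^+,\beta^+],[\beta^+,\alpha^+]$ mapped into itself by both $A$ and $B$ (if it exists); define $I^-$ likewise with $A^{-1},B^{-1},\alpha^-,\beta^-$. The pair is coherently oriented if both exist, and well oriented if $A,B$ is coherently oriented but $A,B^{-1}$ is not. Words: $F_2^+$ is the free semigroup of nonempty words over $\{a,b\}$, $|w|$ the length, $\phi(a)=A,\phi(b)=B$, $[w]=\mathrm{tr}(\phi(w))$. Define $w\preceq u$ iff $[w^{|u|}]\le[u^{|w|}]$; $w$ is maximal if $u\preceq w$ for all $u$. A Lyndon word is one strictly smaller lexicographically ($a<b$) than each of its proper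 rotations. A complete set of optimal words is a set of pairwise distinct maximal Lyndon words such that every maximal word is a power of a rotation of one of them; it is unique if it exists, and its elements are the optimal words. *)

theory Defs
  imports "HOL-Analysis.Analysis"
begin

type_synonym imat = "int^2^2"

definition SL2_nonneg :: "imat \<Rightarrow> bool" where
  "SL2_nonneg A \<longleftrightarrow> (\<forall>i j. A$i$j \<ge> 0) \<and> det A = 1"

definition sl2inv :: "imat \<Rightarrow> imat" where
  "sl2inv A = vector [vector [A$2$2, - A$1$2], vector [- A$2$1, A$1$1]]"

section \<open>The boundary of the upper half plane, P^1(R) = R \<union> {\<infinity>}\<close>

datatype bpt = Fin real | Infty

definition mob :: "imat \<Rightarrow> bpt \<Rightarrow> bpt" where
  "mob A p = (let a = real_of_int (A$1$1); b = real_of_int (A$1$2);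
                  c = real_of_int (A$2$1); d = real_of_int (A$2$2) in
     (case p of
        Fin x \<Rightarrow> (if c * x + d = 0 then Infty else Fin ((a * x + b) / (c * x + d)))
      | Infty \<Rightarrow> (if c = 0 then Infty else Fin (a / c))))"

text \<open>p is a fixed point whose homogeneous representative (x,1) resp. (1,0)
  is an eigenvector of A with eigenvalue l.\<close>
definition eigpt :: "imat \<Rightarrow> bpt \<Rightarrow> real \<Rightarrow> bool" where
  "eigpt A p l = (let a = real_of_int (A$1$1); b = real_of_int (A$1$2);
                  c = real_of_int (A$2$1); d = real_of_int (A$2$2) in
     (case p of
        Fin x \<Rightarrow> a * x + b = l * x \<and> c * x + d = l
      | Infty \<Rightarrow> a = l \<and> c = 0))"

text \<open>Attracting fixed point (eigenvalue of modulus > 1, or the unique fixed point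
  if parabolic) and repelling fixed point (eigenvalue of modulus < 1, or the unique
  fixed point if parabolic).\<close>
definition attr_fp :: "imat \<Rightarrow> bpt" where
  "attr_fp A = (THE p. \<exists>l. \<bar>l\<bar> \<ge> 1 \<and> eigpt A p l)"

definition rep_fp :: "imat \<Rightarrow> bpt" where
  "rep_fp A = (THE p. \<exists>l. \<bar>l\<bar> \<le> 1 \<and> eigpt A p l)"

text \<open>Cyclic (counterclockwise) order on the boundary: increasing along R, through \<infinity>.\<close>
fun ble :: "bpt \<Rightarrow> bpt \<Rightarrow> bool" where
  "ble (Fin x) (Fin y) = (x \<le> y)"
| "ble (Fin x) Infty = True"
| "ble Infty (Fin y) = False"
| "ble Infty Infty = True"

definition ccw_int :: "bpt \<Rightarrow> bpt \<Rightarrow> bpt set" where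
  "ccw_int p q = {x. if ble p q then ble p x \<and> ble x q else ble p x \<or> ble x q}"

definition invariant_int :: "imat \<Rightarrow> imat \<Rightarrow> bpt set \<Rightarrow> bool" where
  "invariant_int A B J \<longleftrightarrow> mob A ` J \<subseteq> J \<and> mob B ` J \<subseteq> J"

definition coherently_oriented :: "imat \<Rightarrow> imat \<Rightarrow> bool" where
  "coherently_oriented A B \<longleftrightarrow>
     (attr_fp A = attr_fp B
       \<or> invariant_int A B (ccw_int (attr_fp A) (attr_fp B))
       \<or> invariant_int A B (ccw_int (attr_fp B) (attr_fp A)))
   \<and> (rep_fp A = rep_fp B
       \<or> invariant_int (sl2inv A) (sl2inv B) (ccw_int (rep_fp A) (rep_fp B))
       \<or> invariant_int (sl2inv A) (sl2inv B) (ccw_int (rep_fp B) (rep_fp A)))"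

definition well_oriented :: "imat \<Rightarrow> imat \<Rightarrow> bool" where
  "well_oriented A B \<longleftrightarrow> coherently_oriented A B \<and> \<not> coherently_oriented A (sl2inv B)"

datatype gen = GA | GB

fun gmat :: "imat \<Rightarrow> imat \<Rightarrow> gen \<Rightarrow> imat" where
  "gmat A B GA = A"
| "gmat A B GB = B"

definition phi :: "imat \<Rightarrow> imat \<Rightarrow> gen list \<Rightarrow> imat" where
  "phi A B w = foldr (\<lambda>x M. gmat A B x ** M) w (mat 1)"

definition wtr :: "imat \<Rightarrow> imat \<Rightarrow> gen list \<Rightarrow> int" where
  "wtr A B w = trace (phi A B w)"

definition wpow :: "gen list \<Rightarrow> nat \<Rightarrow> gen list" where
  "wpow w n = concat (replicate n w)"

definition wle :: "imat \<Rightarrow> imat \<Rightarrow> gen list \<Rightarrow> gen list \<Rightarrow> bool" where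
  "wle A B w u \<longleftrightarrow> wtr A B (wpow w (length u)) \<le> wtr A B (wpow u (length w))"

definition maximal_word :: "imat \<Rightarrow> imat \<Rightarrow> gen list \<Rightarrow> bool" where
  "maximal_word A B w \<longleftrightarrow> w \<noteq> [] \<and> (\<forall>u. u \<noteq> [] \<longrightarrow> wle A B u w)"

text \<open>Strict lexicographic order (a < b) on words of equal length.\<close>
definition lex_less :: "gen list \<Rightarrow> gen list \<Rightarrow> bool" where
  "lex_less u v \<longleftrightarrow> (\<exists>p s t. u = p @ [GA] @ s \<and> v = p @ [GB] @ t)"

definition lyndon :: "gen list \<Rightarrow> bool" where
  "lyndon w \<longleftrightarrow> w \<noteq> [] \<and> (\<forall>k. 0 < k \<and> k < length w \<longrightarrow> lex_less w (rotate k w))"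

definition complete_optimal :: "imat \<Rightarrow> imat \<Rightarrow> gen list set \<Rightarrow> bool" where
  "complete_optimal A B S \<longleftrightarrow>
     (\<forall>w\<in>S. maximal_word A B w \<and> lyndon w)
   \<and> (\<forall>w. maximal_word A B w \<longrightarrow> (\<exists>v\<in>S. \<exists>k n. n \<ge> 1 \<and> w = wpow (rotate k v) n))"

end

theory Submission
  imports Defs
begin

text \<open>
  Let \<open>x, y, z\<close> be the traces of \<open>A, B, AB\<close>; the hypotheses force \<open>z \<ge> xy\<close>.

  Reversing the factor \<open>v\<close> of a cyclic word \<open>uv\<close> changes the trace by a positive multiple of
  \<open>-tr(uK) tr(vK)\<close>, where \<open>K = AB - BA\<close>. Since \<open>BKA = (z - xy)BA + A\<^sup>2 + B\<^sup>2\<close>, the traces \<open>tr(a s b K)\<close>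
  are positive and the traces \<open>tr(b s a K)\<close> negative, so a word of maximal trace for its length cannot
  contain both \<open>aa\<close> and \<open>bb\<close> cyclically. Up to rotation it is thus a word in \<open>a, ab\<close> or in \<open>b, ab\<close>.

  For words in \<open>b\<close> and \<open>c = ab\<close>, diagonalise \<open>AB = diag(r, 1/r)\<close>. The cone between the attracting
  directions of \<open>AB\<close> and \<open>B\<close> is invariant, and on it the first coordinate is multiplied by \<open>r\<close> under \<open>AB\<close>
  and by at most \<open>p = (yr - x)/(r - 1/r)\<close> under \<open>B\<close>. Hence \<open>p < \<surd>r\<close> makes \<open>ab\<close> the only optimal word.
  Integrality shows that this fails only if \<open>z = y\<^sup>2 - 1\<close> and \<open>2x \<le> y\<close>. In that case the reversal argument is
  repeated for the pair \<open>AB, B\<close>, and diagonalising \<open>AB\<^sup>2\<close> shows that \<open>ab\<^sup>2\<close> wins.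
\<close>

section \<open>Real 2 by 2 matrices; word traces as functions of three traces\<close>

section \<open>Two by two matrices\<close>

text \<open>A type of its own makes \<open>*\<close> the matrix product; the entries are real
  because eigenvalues will become entries.\<close>

datatype mat2 = Mat2 real real real real

instantiation mat2 :: ring_1
begin

definition "0 = Mat2 0 0 0 0"
definition "1 = Mat2 1 0 0 1"
fun plus_mat2 where "Mat2 a b c d + Mat2 a' b' c' d' = Mat2 (a + a') (b + b') (c + c') (d + d')"
fun minus_mat2 where "Mat2 a b c d - Mat2 a' b' c' d' = Mat2 (a - a') (b - b') (c - c') (d - d')"
fun uminus_mat2 where "- Mat2 a b c d = Mat2 (- a) (- b) (- c) (- d)"
fun times_mat2 where
  "Mat2 a b c d * Mat2 a' b' c' d' = Mat2 (a*a' + b*c') (a*b' + b*d') (c*a' + d*c') (c*b' + d*d')"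

instance
proof
  fix X Y Z :: mat2
  show "X * Y * Z = X * (Y * Z)" "(X + Y) * Z = X * Z + Y * Z" "X * (Y + Z) = X * Y + X * Z"
    by (cases X; cases Y; cases Z; simp add: algebra_simps)+
  show "X + Y + Z = X + (Y + Z)" "X + Y = Y + X" "X - Y = X + - Y"
    by (cases X; cases Y; cases Z; simp)+
  show "0 + X = X" "- X + X = 0" "1 * X = X" "X * 1 = X"
    by (cases X; simp add: zero_mat2_def one_mat2_def)+
  show "(0::mat2) \<noteq> 1"
    by (simp add: zero_mat2_def one_mat2_def)
qed

end

fun tr2 :: "mat2 \<Rightarrow> real" where "tr2 (Mat2 a b c d) = a + d"
fun det2 :: "mat2 \<Rightarrow> real" where "det2 (Mat2 a b c d) = a * d - b * c"
fun adj2 :: "mat2 \<Rightarrow> mat2" where "adj2 (Mat2 a b c d) = Mat2 d (- b) (- c) a"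
definition sc :: "real \<Rightarrow> mat2" where "sc r = Mat2 r 0 0 r"

lemma tr2_one [simp]: "tr2 1 = 2" and det2_one [simp]: "det2 1 = 1" and adj2_one [simp]: "adj2 1 = 1"
  by (simp_all add: one_mat2_def)

lemma tr2_add: "tr2 (X + Y) = tr2 X + tr2 Y" and tr2_diff: "tr2 (X - Y) = tr2 X - tr2 Y"
  and tr2_sc: "tr2 (sc r * X) = r * tr2 X"
  by (cases X; cases Y; simp add: sc_def algebra_simps)+

lemma tr2_mult_commute: "tr2 (X * Y) = tr2 (Y * X)"
  by (cases X; cases Y; simp add: algebra_simps)

lemma det2_mult: "det2 (X * Y) = det2 X * det2 Y"
  by (cases X; cases Y; simp add: algebra_simps)

lemma adj2_mult: "adj2 (X * Y) = adj2 Y * adj2 X"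
  by (cases X; cases Y; simp add: algebra_simps)

lemma tr2_square: "det2 X = 1 \<Longrightarrow> tr2 (X * X) = (tr2 X)\<^sup>2 - 2"
  by (cases X; simp add: algebra_simps power2_eq_square)

lemma tr2_square_mult:
  assumes "det2 X = 1"
  shows "tr2 (X * (X * Y)) = tr2 X * tr2 (X * Y) - tr2 Y"
proof -
  obtain a b c d a' b' c' d' where *: "X = Mat2 a b c d" "Y = Mat2 a' b' c' d'"
    by (metis mat2.exhaust)
  with assms have "a * d - b * c = 1" by simp
  then show ?thesis unfolding * by simp algebra
qed

text \<open>The basis \<open>1, X, Y, XY\<close>: multiplication by \<open>X\<close> and by \<open>Y\<close> acts on the coordinates through the
  three traces alone.\<close>

definition lin :: "mat2 \<Rightarrow> mat2 \<Rightarrow> real \<Rightarrow> real \<Rightarrow> real \<Rightarrow> real \<Rightarrow> mat2" where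
  "lin X Y a b c d = sc a + sc b * X + sc c * Y + sc d * (X * Y)"

lemma mult_lin_left:
  assumes "det2 X = 1"
  shows "X * lin X Y a b c d = lin X Y (- b) (a + b * tr2 X) (- d) (c + d * tr2 X)"
proof (cases X; cases Y)
  fix p q r s p' q' r' s'
  assume *: "X = Mat2 p q r s" "Y = Mat2 p' q' r' s'"
  with assms have "p * s - q * r = 1" by simp
  then show ?thesis unfolding * lin_def sc_def by (simp; intro conjI; algebra)
qed

lemma mult_lin_right:
  assumes "det2 X = 1" "det2 Y = 1"
  defines "x \<equiv> tr2 X" and "y \<equiv> tr2 Y" and "z \<equiv> tr2 (X * Y)"
  shows "Y * lin X Y a b c d
    = lin X Y (b * (z - x * y) - c - d * x) (b * y + d) (a + b * x + c * y + d * z) (- b)"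
proof (cases X; cases Y)
  fix p q r s p' q' r' s'
  assume *: "X = Mat2 p q r s" "Y = Mat2 p' q' r' s'"
  with assms have "p * s - q * r = 1" "p' * s' - q' * r' = 1" by simp_all
  then show ?thesis unfolding * lin_def sc_def x_def y_def z_def by (simp; intro conjI; algebra)
qed

fun ev :: "mat2 \<Rightarrow> mat2 \<Rightarrow> gen list \<Rightarrow> mat2" where
  "ev X Y [] = 1"
| "ev X Y (GA # w) = X * ev X Y w"
| "ev X Y (GB # w) = Y * ev X Y w"

lemma ev_append: "ev X Y (u @ v) = ev X Y u * ev X Y v"
  by (induction X Y u rule: ev.induct) (simp_all add: mult.assoc)

lemma det2_ev: "det2 X = 1 \<Longrightarrow> det2 Y = 1 \<Longrightarrow> det2 (ev X Y w) = 1"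
  by (induction X Y w rule: ev.induct) (simp_all add: det2_mult)

text \<open>In the basis \<open>1, X, Y, XY\<close> both pairs follow the same recursion. This lets
  a pair be replaced by a normal form without exhibiting a conjugation.\<close>

lemma tr2_ev_cong:
  assumes "det2 X = 1" "det2 Y = 1" "det2 X' = 1" "det2 Y' = 1"
    and "tr2 X = tr2 X'" "tr2 Y = tr2 Y'" "tr2 (X * Y) = tr2 (X' * Y')"
  shows "tr2 (ev X Y w) = tr2 (ev X' Y' w)"
proof -
  have "\<exists>a b c d. ev X Y w = lin X Y a b c d \<and> ev X' Y' w = lin X' Y' a b c d"
  proof (induction w)
    case Nil
    have "1 = lin Z W 1 0 0 0" for Z W
      by (cases Z; cases W; simp add: lin_def sc_def one_mat2_def)
    then show ?case by (metis ev.simps(1))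
  next
    case (Cons g w)
    then obtain a b c d where "ev X Y w = lin X Y a b c d" "ev X' Y' w = lin X' Y' a b c d"
      by blast
    with assms show ?case
      by (cases g) (auto simp: mult_lin_left mult_lin_right)
  qed
  then obtain a b c d where "ev X Y w = lin X Y a b c d" "ev X' Y' w = lin X' Y' a b c d"
    by blast
  moreover have "tr2 (lin Z W a b c d) = 2 * a + b * tr2 Z + c * tr2 W + d * tr2 (Z * W)" for Z W
    by (simp add: lin_def tr2_add tr2_sc) (simp add: sc_def)
  ultimately show ?thesis using assms by simp
qed

section \<open>Trace change under reversal of a factor\<close>

section \<open>Reversal\<close>

definition comm2 :: "mat2 \<Rightarrow> mat2 \<Rightarrow> mat2" where "comm2 X Y = X * Y - Y * X"

text \<open>With \<open>K = comm2 X Y\<close>, both \<open>K\<close> and \<open>XK\<close> are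
  traceless, so polarised Cayley-Hamilton reads \<open>XK + KX = (tr X) K\<close>; and
  \<open>adj2 X\<close> is \<open>tr X - X\<close>.\<close>

lemma adj2_comm2_left: "adj2 X * comm2 X Y = comm2 X Y * X"
  by (cases X; cases Y; simp add: comm2_def algebra_simps)

lemma adj2_comm2_right: "adj2 Y * comm2 X Y = comm2 X Y * Y"
  by (cases X; cases Y; simp add: comm2_def algebra_simps)

text \<open>\<open>adj2\<close> reverses products, and moving \<open>K\<close> across turns the
  adjugate of each letter back into the letter. Thus \<open>K\<close> implements reversal of
  words.\<close>

lemma adj2_ev_comm2: "adj2 (ev X Y w) * comm2 X Y = comm2 X Y * ev X Y (rev w)"
proof (induction w)
  case (Cons g w)
  define G where "G = (case g of GA \<Rightarrow> X | GB \<Rightarrow> Y)"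
  have G: "ev X Y (g # u) = G * ev X Y u" "adj2 G * comm2 X Y = comm2 X Y * G" for u
    by (cases g; simp add: G_def adj2_comm2_left adj2_comm2_right)+
  have "adj2 (ev X Y (g # w)) * comm2 X Y = adj2 (ev X Y w) * comm2 X Y * G"
    by (simp add: G adj2_mult mult.assoc)
  also have "\<dots> = comm2 X Y * ev X Y (rev (g # w))"
    by (simp add: Cons ev_append G mult.assoc)
  finally show ?case .
qed simp

lemma tr2_adj2_traceless: "tr2 K = 0 \<Longrightarrow> tr2 (adj2 W * K) = - tr2 (W * K)"
  by (cases W; cases K; simp add: add_eq_0_iff2)

text \<open>As \<open>adj2 K = - K\<close>, adding \<open>VK\<close> to its adjugate gives
  \<open>VK - K adj2 V = tr (VK)\<close>. Multiply by \<open>K\<close> on the right and by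
  \<open>U\<close> on the left, use \<open>K^2 = - det K\<close>, and take traces.\<close>

lemma traceless_sandwich:
  assumes "tr2 K = 0"
  shows "- det2 K * tr2 (U * V) - tr2 (U * (K * adj2 V * K)) = tr2 (U * K) * tr2 (V * K)"
proof -
  obtain a b c d where K: "K = Mat2 a b c d" by (cases K)
  with assms have "d = - a" by simp
  with K show ?thesis by (cases U; cases V; simp add: algebra_simps)
qed

lemma traceless_square: "tr2 K = 0 \<Longrightarrow> K * K = sc (- det2 K)"
  by (cases K) (auto simp: sc_def add_eq_0_iff2)

lemma tr2_comm2: "tr2 (comm2 X Y) = 0"
  by (simp add: comm2_def tr2_diff tr2_mult_commute)

text \<open>Up to rotation, words from \<open>a\<close> to \<open>b\<close> have positive trace
  against the commutator. The inequality \<open>tr2 X * tr2 Y \<le> tr2 (X * Y)\<close> is lost in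
  passing to \<open>X * Y, Y\<close> when \<open>tr2 X\<close> is positive, whereas this condition
  is inherited.\<close>

definition pos_pair :: "mat2 \<Rightarrow> mat2 \<Rightarrow> bool" where
  "pos_pair X Y \<longleftrightarrow> det2 X = 1 \<and> det2 Y = 1 \<and> (\<forall>w. 0 < tr2 (ev X Y w * (Y * comm2 X Y * X)))"

lemma pos_pair_comm2:
  assumes "det2 X = 1" "det2 Y = 1"
  shows "Y * comm2 X Y * X = sc (tr2 (X * Y) - tr2 X * tr2 Y) * (Y * X) + X * X + Y * Y"
proof -
  obtain a b c d a' b' c' d' where *: "X = Mat2 a b c d" "Y = Mat2 a' b' c' d'"
    by (metis mat2.exhaust)
  with assms have "a * d - b * c = 1" "a' * d' - b' * c' = 1" by simp_all
  then show ?thesis unfolding * comm2_def sc_def by (simp; intro conjI; algebra)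
qed

lemma pos_pairI:
  assumes "det2 X = 1" "det2 Y = 1"
    and pos: "\<And>w. 0 < tr2 (ev X Y w)" and "tr2 X * tr2 Y \<le> tr2 (X * Y)"
  shows "pos_pair X Y"
  unfolding pos_pair_def
proof (intro conjI allI assms)
  fix w
  have "ev X Y w * (Y * comm2 X Y * X)
    = sc (tr2 (X * Y) - tr2 X * tr2 Y) * (ev X Y w * (Y * X)) + ev X Y w * (X * X) + ev X Y w * (Y * Y)"
  proof -
    have "M * (sc r * N) = sc r * (M * N)" for M N r
      by (cases M; cases N; simp add: sc_def algebra_simps)
    then show ?thesis by (simp add: pos_pair_comm2 assms distrib_left)
  qed
  moreover have "tr2 (ev X Y w * (Y * X)) > 0" "tr2 (ev X Y w * (X * X)) > 0"
    "tr2 (ev X Y w * (Y * Y)) > 0"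
    using pos[of "w @ [GB, GA]"] pos[of "w @ [GA, GA]"] pos[of "w @ [GB, GB]"]
    by (simp_all add: ev_append)
  ultimately show "0 < tr2 (ev X Y w * (Y * comm2 X Y * X))"
    using assms(4) by (simp add: tr2_add tr2_sc add_nonneg_pos)
qed

text \<open>The first sign is the definition after a rotation. For the second, reversing the word
  amounts, in the trace against \<open>K\<close>, to taking the adjugate, which flips the sign
  because \<open>K\<close> is traceless.\<close>

lemma pos_pair_tr2_comm2:
  assumes "pos_pair X Y"
  shows "0 < tr2 (ev X Y (GA # s @ [GB]) * comm2 X Y)" "tr2 (ev X Y (GB # s @ [GA]) * comm2 X Y) < 0"
proof -
  have *: "0 < tr2 (ev X Y (GA # s @ [GB]) * comm2 X Y)" for s
  proof -
    have "tr2 (ev X Y (GA # s @ [GB]) * comm2 X Y) = tr2 (ev X Y s * (Y * comm2 X Y * X))"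
      using tr2_mult_commute[of X "ev X Y s * (Y * comm2 X Y)"]
      by (simp add: ev_append mult.assoc)
    with assms show ?thesis by (simp add: pos_pair_def)
  qed
  then show "0 < tr2 (ev X Y (GA # s @ [GB]) * comm2 X Y)" .
  have "tr2 (comm2 X Y * ev X Y (rev (GA # rev s @ [GB])))
      = - tr2 (ev X Y (GA # rev s @ [GB]) * comm2 X Y)"
    by (simp only: flip: adj2_ev_comm2) (rule tr2_adj2_traceless[OF tr2_comm2])
  with *[of "rev s"] show "tr2 (ev X Y (GB # s @ [GA]) * comm2 X Y) < 0"
    by (simp add: tr2_mult_commute)
qed

text \<open>This is the constant in front of the reversal identity. Twice it is
  \<open>tr (K^2) = tr (XYK) - tr (YXK)\<close>, a positive trace minus a negative one.\<close>

lemma neg_det2_comm2_pos: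
  assumes "pos_pair X Y"
  shows "0 < - det2 (comm2 X Y)"
proof -
  let ?K = "comm2 X Y"
  have "2 * (- det2 ?K) = tr2 (?K * ?K)"
    by (simp add: traceless_square tr2_comm2) (simp add: sc_def)
  also have "\<dots> = tr2 (X * Y * ?K) - tr2 (Y * X * ?K)"
    by (subst (1) comm2_def) (simp add: left_diff_distrib tr2_diff)
  also have "\<dots> > 0"
    using pos_pair_tr2_comm2[OF assms, of "[]"] by simp
  finally show ?thesis by simp
qed

text \<open>\<open>-det K (tr(UV) - tr(U rev V)) = tr(UK) tr(VK)\<close> for \<open>K = XY - YX\<close>.\<close>

lemma tr2_ev_reverse_factor_less:
  assumes "pos_pair X Y"
  shows "tr2 (ev X Y (GA # s @ [GB, GB] @ t @ [GA])) < tr2 (ev X Y (GB # rev s @ [GA, GB] @ t @ [GA]))"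
proof -
  let ?K = "comm2 X Y" let ?u = "GB # t @ [GA]" let ?v = "GA # s @ [GB]"
  let ?U = "ev X Y ?u" and ?V = "ev X Y ?v" and ?V' = "ev X Y (rev ?v)"
  have "?U * (?K * adj2 ?V * ?K) = sc (- det2 ?K) * (?U * ?V')"
  proof -
    have "?K * adj2 ?V * ?K = ?K * ?K * ?V'"
      using adj2_ev_comm2[of X Y ?v] by (simp add: mult.assoc)
    moreover have "M * (sc r * N) = sc r * (M * N)" for M N r
      by (cases M; cases N; simp add: sc_def algebra_simps)
    ultimately show ?thesis by (simp add: traceless_square tr2_comm2)
  qed
  then have "- det2 ?K * (tr2 (?U * ?V) - tr2 (?U * ?V')) = tr2 (?U * ?K) * tr2 (?V * ?K)"
    using traceless_sandwich[OF tr2_comm2, of X Y ?U ?V] by (simp add: tr2_sc algebra_simps)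
  \<comment> \<open>\<open>?u\<close> runs from \<open>b\<close> to \<open>a\<close> and
    \<open>?v\<close> from \<open>a\<close> to \<open>b\<close>, so the factors have opposite
    signs.\<close>
  moreover have "tr2 (?U * ?K) * tr2 (?V * ?K) < 0"
    using pos_pair_tr2_comm2[OF assms] by (simp add: mult_neg_pos)
  ultimately have "tr2 (?U * ?V) < tr2 (?U * ?V')"
    using neg_det2_comm2_pos[OF assms] by (smt (verit) mult_nonneg_nonneg)
  then have "tr2 (?V * ?U) < tr2 (?V' * ?U)"
    using tr2_mult_commute[of ?U ?V] tr2_mult_commute[of ?U ?V'] by simp
  moreover have "ev X Y (GA # s @ [GB, GB] @ t @ [GA]) = ?V * ?U"
    "ev X Y (GB # rev s @ [GA, GB] @ t @ [GA]) = ?V' * ?U"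
    by (simp_all add: ev_append mult.assoc)
  ultimately show ?thesis by simp
qed

section \<open>Regrouping words into the letters a, ab or b, ab\<close>

section \<open>Substitutions\<close>

fun sub_a :: "gen list \<Rightarrow> gen list" where
  "sub_a [] = []"
| "sub_a (GA # w) = GA # sub_a w"
| "sub_a (GB # w) = GA # GB # sub_a w"

fun sub_b :: "gen list \<Rightarrow> gen list" where
  "sub_b [] = []"
| "sub_b (GA # w) = GA # GB # sub_b w"
| "sub_b (GB # w) = GB # sub_b w"

lemma sub_append: "sub_a (u @ v) = sub_a u @ sub_a v" "sub_b (u @ v) = sub_b u @ sub_b v"
  by (induction u rule: sub_a.induct) simp_all

lemma ev_sub_a: "ev X Y (sub_a w) = ev X (X * Y) w"
  by (induction w rule: sub_a.induct) (simp_all add: mult.assoc)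

lemma ev_sub_b: "ev X Y (sub_b w) = ev (X * Y) Y w"
  by (induction w rule: sub_b.induct) (simp_all add: mult.assoc)

lemma length_sub_a: "length (sub_a w) = count_list w GA + 2 * count_list w GB"
  by (induction w rule: sub_a.induct) simp_all

lemma length_sub_b: "length (sub_b w) = 2 * count_list w GA + count_list w GB"
  by (induction w rule: sub_b.induct) simp_all

lemma sub_b_snoc: "\<exists>s. GB # sub_b w = s @ [GB]"
proof (cases w rule: rev_cases)
  case (snoc u g)
  then show ?thesis by (cases g) (auto simp: sub_append)
qed simp

text \<open>\<open>comm2 (X * Y) Y\<close> is \<open>KY\<close>, and \<open>YKY = K\<close> since
  \<open>adj2 Y\<close> inverts \<open>Y\<close>. The trace in question becomes that of a word from
  \<open>a\<close> to \<open>b\<close> against \<open>K\<close>; \<open>sub_b_snoc\<close> supplies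
  the final \<open>b\<close>.\<close>

lemma pos_pair_mult:
  assumes "pos_pair X Y"
  shows "pos_pair (X * Y) Y"
  unfolding pos_pair_def
proof (intro conjI allI)
  show "det2 (X * Y) = 1" "det2 Y = 1"
    using assms by (simp_all add: pos_pair_def det2_mult)
  fix w
  let ?K = "comm2 X Y"
  have "Y * adj2 Y = 1"
    using assms by (cases Y) (simp add: pos_pair_def one_mat2_def algebra_simps)
  then have YKY: "Y * ?K * Y = ?K"
    using adj2_comm2_right[of Y X] by (metis mult.assoc mult_1)
  have "Y * comm2 (X * Y) Y * (X * Y) = Y * ?K * Y * (X * Y)"
    by (simp add: comm2_def algebra_simps)
  then have "Y * comm2 (X * Y) Y * (X * Y) = ?K * (X * Y)"
    by (simp only: YKY)
  then have "tr2 (ev (X * Y) Y w * (Y * comm2 (X * Y) Y * (X * Y))) = tr2 (X * Y * ev (X * Y) Y w * ?K)"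
    using tr2_mult_commute[of "ev (X * Y) Y w * ?K" "X * Y"] by (simp add: mult.assoc)
  also have "X * Y * ev (X * Y) Y w = ev X Y (GA # GB # sub_b w)"
    by (simp add: ev_sub_b mult.assoc)
  also obtain s where "GB # sub_b w = s @ [GB]"
    using sub_b_snoc by blast
  finally show "0 < tr2 (ev (X * Y) Y w * (Y * comm2 (X * Y) Y * (X * Y)))"
    using pos_pair_tr2_comm2(1)[OF assms, of s] by simp
qed

lemma sub_a_image:
  assumes "w = [] \<or> hd w = GA" "\<nexists>p q. w = p @ [GB, GB] @ q"
  shows "\<exists>u. w = sub_a u"
  using assms
proof (induction "length w" arbitrary: w rule: less_induct)
  case less
  have IH: "\<exists>u. v = sub_a u" if "w = p @ v" "p \<noteq> []" "v = [] \<or> hd v = GA" for p v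
  proof (rule less.hyps)
    show "length v < length w" "v = [] \<or> hd v = GA" using that by simp_all
    show "\<nexists>p q. v = p @ [GB, GB] @ q" using that(1) less.prems(2) by (metis append.assoc)
  qed
  show ?case
  proof (cases w)
    case Nil
    then show ?thesis by (metis sub_a.simps(1))
  next
    case (Cons g r)
    with less.prems have w: "w = GA # r" by simp
    show ?thesis
    proof (cases "r = [] \<or> hd r = GA")
      case True
      with IH[of "[GA]" r] w obtain u where "r = sub_a u" by auto
      with w show ?thesis by (metis sub_a.simps(2))
    next
      case False
      then obtain r' where r: "r = GB # r'"
        by (metis gen.exhaust list.exhaust_sel)
      have "r' = [] \<or> hd r' = GA"
        using less.prems(2) w r by (metis append_Cons append_Nil gen.exhaust list.exhaust_sel)
      with IH[of "[GA, GB]" r'] w r obtain u where "r' = sub_a u" by auto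
      with w r show ?thesis by (metis sub_a.simps(3))
    qed
  qed
qed

lemma sub_b_image:
  assumes "w = [] \<or> last w = GB" "\<nexists>p q. w = p @ [GA, GA] @ q"
  shows "\<exists>u. w = sub_b u"
  using assms
proof (induction "length w" arbitrary: w rule: less_induct)
  case less
  have IH: "\<exists>u. v = sub_b u" if "w = p @ v" "p \<noteq> []" for p v
  proof (rule less.hyps)
    show "length v < length w" "v = [] \<or> last v = GB" using that less.prems(1) by (auto simp: last_append split: if_splits)
    show "\<nexists>p q. v = p @ [GA, GA] @ q" using that(1) less.prems(2) by (metis append.assoc)
  qed
  show ?case
  proof (cases w)
    case Nil
    then show ?thesis by (metis sub_b.simps(1))
  next
    case (Cons g r)
    show ?thesis
    proof (cases g)
      case GB
      with IH[of "[GB]" r] Cons obtain u where "r = sub_b u" by auto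
      with Cons GB show ?thesis by (metis sub_b.simps(3))
    next
      case GA
      with Cons less.prems have "r \<noteq> []" by auto
      moreover have "hd r \<noteq> GA"
        using less.prems(2) Cons GA \<open>r \<noteq> []\<close> by (metis append_Cons append_Nil list.exhaust_sel)
      ultimately obtain r' where r: "r = GB # r'"
        by (metis gen.exhaust list.exhaust_sel)
      with IH[of "[GA, GB]" r'] Cons GA obtain u where "r' = sub_b u" by auto
      with Cons GA r show ?thesis by (metis sub_b.simps(2))
    qed
  qed
qed

section \<open>Cyclic words and their three shapes\<close>

section \<open>Rotations\<close>

definition rotation_of :: "'a list \<Rightarrow> 'a list \<Rightarrow> bool" where
  "rotation_of u w \<longleftrightarrow> (\<exists>k. u = rotate k w)"

lemma rotation_of_iff: "rotation_of u w \<longleftrightarrow> (\<exists>p q. w = p @ q \<and> u = q @ p)"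
proof
  assume "rotation_of u w"
  then show "\<exists>p q. w = p @ q \<and> u = q @ p"
    unfolding rotation_of_def by (metis append_take_drop_id rotate_drop_take)
next
  assume "\<exists>p q. w = p @ q \<and> u = q @ p"
  then show "rotation_of u w"
    unfolding rotation_of_def by (metis rotate_append)
qed

lemma rotation_of_refl: "rotation_of w w"
  unfolding rotation_of_iff by (metis append_Nil append_Nil2)

lemma rotation_of_sym: "rotation_of u w \<Longrightarrow> rotation_of w u"
  unfolding rotation_of_iff by blast

lemma rotation_of_trans: "rotation_of u v \<Longrightarrow> rotation_of v w \<Longrightarrow> rotation_of u w"
  unfolding rotation_of_def by (metis rotate_rotate)

lemma rotation_of_length: "rotation_of u w \<Longrightarrow> length u = length w"
  unfolding rotation_of_def by auto

lemma rotation_of_count_list: "rotation_of u w \<Longrightarrow> count_list u x = count_list w x"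
  unfolding rotation_of_iff by auto

lemma rotation_of_sub_b: "rotation_of u w \<Longrightarrow> rotation_of (sub_b u) (sub_b w)"
  unfolding rotation_of_iff by (metis sub_append(2))

lemma tr2_ev_rotation: "rotation_of u w \<Longrightarrow> tr2 (ev X Y u) = tr2 (ev X Y w)"
  unfolding rotation_of_iff by (metis ev_append tr2_mult_commute)

text \<open>A rotation with \<open>a\<close> at both ends exposes a cyclic \<open>aa\<close> (or is
  the single letter \<open>a\<close>): either it contains \<open>bb\<close>, or it parses over
  \<open>a, ab\<close>. Without such a rotation there is no cyclic \<open>aa\<close>, and a rotation
  ending in \<open>b\<close> (or the empty word) parses over \<open>b, ab\<close>.\<close>

lemma rotation_cases:
  fixes w :: "gen list"
  obtains (sub_a) u where "rotation_of (sub_a u) w"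
  | (sub_b) u where "rotation_of (sub_b u) w"
  | (unbalanced) s t where "rotation_of (GA # s @ [GB, GB] @ t @ [GA]) w"
proof (cases "\<exists>v. rotation_of v w \<and> v \<noteq> [] \<and> hd v = GA \<and> last v = GA")
  case True
  then obtain v where v: "rotation_of v w" "v \<noteq> []" "hd v = GA" "last v = GA" by blast
  show thesis
  proof (cases "\<exists>p q. v = p @ [GB, GB] @ q")
    case True
    then obtain p q where pq: "v = p @ [GB, GB] @ q" by blast
    with v obtain s where "p = GA # s" by (cases p) auto
    moreover from pq v obtain t where "q = t @ [GA]" by (cases q rule: rev_cases) auto
    ultimately show thesis using unbalanced v(1) pq by simp
  next
    case False
    with sub_a_image[of v] v show thesis by (metis that(1))
  qed
next
  case False
  obtain v where v: "rotation_of v w" "v = [] \<or> last v = GB"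
  proof (cases "w = [] \<or> last w = GB")
    case True
    with that rotation_of_refl show thesis by blast
  next
    case F: False
    then have "hd w = GB" "w \<noteq> []"
      using False rotation_of_refl by (metis gen.exhaust)+
    then have "rotation_of (tl w @ [GB]) w"
      unfolding rotation_of_iff by (metis append_Cons append_Nil list.collapse)
    with that show thesis by simp
  qed
  have "\<nexists>p q. v = p @ [GA, GA] @ q"
  proof
    assume "\<exists>p q. v = p @ [GA, GA] @ q"
    then obtain p q where "v = (p @ [GA]) @ (GA # q)" by auto
    then have "rotation_of (GA # q @ p @ [GA]) v"
      unfolding rotation_of_iff by (metis append_Cons)
    with v(1) have "rotation_of (GA # q @ p @ [GA]) w"
      using rotation_of_trans by blast
    with False show False by (metis append_is_Nil_conv last.simps last_appendR list.sel(1) list.simps(3))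
  qed
  with sub_b_image[of v] v show thesis by (metis that(2))
qed

section \<open>Upper bounds for word traces from an invariant cone\<close>

section \<open>Growth in an invariant cone\<close>

lemma ex_add_inverse_eq:
  fixes s :: real
  assumes "2 \<le> s"
  obtains r where "1 \<le> r" "r + 1 / r = s"
proof
  have s: "0 \<le> s\<^sup>2 - 4"
    using power_mono[of 2 s 2] assms by simp
  define q where "q = sqrt (s\<^sup>2 - 4)"
  have q: "0 \<le> q" "q\<^sup>2 = s\<^sup>2 - 4" using s by (simp_all add: q_def)
  have "2 \<le> s + q" using q(1) assms by simp
  then show "1 \<le> (s + q) / 2" by simp
  have "((s + q) / 2) * ((s + q) / 2) + 1 = s * ((s + q) / 2)"
    using q(2) by (simp add: field_simps power2_eq_square)
  then show "(s + q) / 2 + 1 / ((s + q) / 2) = s"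
    using q(1) assms by (simp add: add_divide_eq_iff)
qed

lemma add_inverse_strict_mono:
  fixes m n :: real
  assumes "1 \<le> m" "m < n"
  shows "m + 1 / m < n + 1 / n"
proof -
  have "1 * 1 < n * m" using assms by (intro mult_less_le_imp_less) auto
  then have "0 < (n - m) * (n * m - 1)"
    using assms by (intro mult_pos_pos) auto
  then show ?thesis using assms by (simp add: field_simps)
qed

text \<open>In an eigenbasis of \<open>P\<close> one has \<open>P = diag(r, 1/r)\<close> and \<open>X = (p, -q; q, t)\<close>, and the cone
  between the attracting directions of \<open>P\<close> and \<open>X\<close> is invariant. On it the first coordinate grows at
  most by the factors \<open>r\<close> and \<open>p\<close>.\<close>

lemma tr2_ev_le:
  assumes det: "det2 X = 1" "det2 P = 1"
    and r: "1 < r" "tr2 P = r + 1 / r"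
    and p: "p * (r - 1 / r) = tr2 (X * P) - tr2 X / r" "p * (tr2 X - p) < 1"
      "tr2 X \<le> 2 * p" "p \<le> tr2 X" and X: "2 \<le> tr2 X"
  obtains m where "1 \<le> m" "m \<le> p ^ count_list w GA * r ^ count_list w GB"
    "tr2 (ev X P w) \<le> m + 1 / m"
proof -
  \<comment> \<open>The trace of \<open>X\<close> fixes \<open>t\<close> and its determinant fixes
    \<open>q\<close>, while \<open>p\<close> is dictated by \<open>tr2 (X * P)\<close>; hence the
    normal form has the same word traces.\<close>
  define t where "t = tr2 X - p"
  define q where "q = sqrt (1 - p * t)"
  have q: "0 < q" "q * q = 1 - p * t"
    using p(2) by (simp_all add: q_def t_def)
  have t: "0 \<le> t" using p by (simp add: t_def)
  obtain l where l: "1 \<le> l" "l + 1 / l = tr2 X"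
    using ex_add_inverse_eq X by blast
  define k where "k = 1 / l"
  have k: "0 < k" "k \<le> l" "k * l = 1" "l + k = p + t"
    using l by (auto simp: k_def t_def field_simps intro: order_trans[OF l(1)] mult_mono[of 1 l 1 l, simplified])
  \<comment> \<open>\<open>l\<close> and \<open>k\<close> are the eigenvalues of \<open>X\<close>.
    As \<open>(p - l) * (p - k)\<close> is positive and \<open>p\<close> is at least their mean,
    \<open>p\<close> lies above both.\<close>
  have pl: "l \<le> p"
  proof (rule ccontr)
    assume "\<not> l \<le> p"
    moreover have "k \<le> p" using k p(3) by (simp add: t_def)
    ultimately have "(p - l) * (p - k) \<le> 0" by (simp add: mult_nonpos_nonneg)
    moreover have "(p - l) * (p - k) = 1 - p * t"
    proof -
      have "(p - l) * (p - k) = p * p - p * (l + k) + k * l" by (simp add: algebra_simps)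
      then show ?thesis unfolding k(3,4) by (simp add: algebra_simps)
    qed
    ultimately show False using p(2) by (simp add: t_def)
  qed
  define X' where "X' = Mat2 p (- q) q t"
  define P' where "P' = Mat2 r 0 0 (1 / r)"
  have "tr2 (X' * P') = tr2 (X * P)"
    using p(1) by (simp add: X'_def P'_def t_def algebra_simps diff_divide_distrib)
  then have tr: "tr2 (ev X P w) = tr2 (ev X' P' w)"
    using r det q by (intro tr2_ev_cong) (simp_all add: X'_def P'_def t_def algebra_simps)
  \<comment> \<open>The first column stays between the first axis and the eigendirection
    \<open>q c = (p - l) a\<close> for \<open>l\<close>. There \<open>X'\<close> multiplies
    \<open>a\<close> by a factor between \<open>l\<close> and \<open>p\<close>. The sign of
    \<open>b\<close> is carried along because \<open>b c \<le> 0\<close> bounds \<open>d\<close> by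
    \<open>1 / a\<close> at the end.\<close>
  have "\<exists>a b c d. ev X' P' w = Mat2 a b c d \<and> a * d - b * c = 1 \<and> b \<le> 0 \<and> 0 \<le> c
     \<and> q * c \<le> (p - l) * a \<and> 1 \<le> a \<and> a \<le> p ^ count_list w GA * r ^ count_list w GB" for w
  proof (induction w)
    case Nil
    then show ?case using pl by (simp add: one_mat2_def)
  next
    case (Cons g w)
    let ?M = "p ^ count_list w GA * r ^ count_list w GB"
    obtain a b c d where W: "ev X' P' w = Mat2 a b c d" "a * d - b * c = 1" "b \<le> 0" "0 \<le> c"
      "q * c \<le> (p - l) * a" "1 \<le> a" "a \<le> ?M"
      using Cons by blast
    show ?case
    proof (cases g)
      case GA
      have la: "l * a \<le> p * a - q * c" using W(5) by (simp add: algebra_simps)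
      have 1: "1 \<le> p * a - q * c" using la l(1) W(6) mult_mono[of 1 l 1 a] by simp
      have 2: "p * a - q * c \<le> p * ?M"
        using W(7) mult_left_mono[of a ?M p] q(1) W(4) pl l(1) by (smt (verit) mult_nonneg_nonneg)
      have 3: "p * b - q * d \<le> 0"
      proof -
        \<comment> \<open>Multiplying by \<open>a\<close> lets the determinant absorb
          \<open>d\<close>, whose sign is not tracked.\<close>
        have "a * (p * b - q * d) = b * (p * a - q * c) - q * (a * d - b * c)"
          by (simp add: algebra_simps)
        also have "\<dots> \<le> 0"
          using W 1 q(1) mult_nonpos_nonneg[of b "p * a - q * c"] by simp
        finally show ?thesis using W(6) by (simp add: mult_le_0_iff)
      qed
      have 4: "0 \<le> q * a + t * c" using q t W by simp
      \<comment> \<open>The form \<open>(p - l) a - q c\<close> is a left eigenvector of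
        \<open>X'\<close> with eigenvalue \<open>k\<close>.\<close>
      have 5: "q * (q * a + t * c) \<le> (p - l) * (p * a - q * c)"
      proof -
        have "(p - l) * (p * a - q * c) - q * (q * a + t * c)
          = ((p - l) * p - q * q) * a - (t + p - l) * (q * c)" by (simp add: algebra_simps)
        also have "(p - l) * p - q * q = k * (p - l)"
          using q(2) k(3,4) by algebra
        also have "t + p - l = k" using k(4) by simp
        also have "k * (p - l) * a - k * (q * c) = k * ((p - l) * a - q * c)"
          by (simp add: algebra_simps)
        also have "\<dots> \<ge> 0" using k W by simp
        finally show ?thesis by simp
      qed
      have 6: "(p * a - q * c) * (q * b + t * d) - (p * b - q * d) * (q * a + t * c) = 1"
        using W(2) q(2) by algebra
      have "ev X' P' (g # w) = Mat2 (p * a - q * c) (p * b - q * d) (q * a + t * c) (q * b + t * d)"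
        by (simp add: GA W(1)) (simp add: X'_def)
      then show ?thesis using GA 1 2 3 4 5 6 by (simp add: mult.assoc)
    next
      case GB
      have 1: "a \<le> r * a" using mult_right_mono[of 1 r a] r W by simp
      have 2: "c / r \<le> c" using r W mult_left_mono[of 1 r c] by (simp add: field_simps)
      have "q * (c / r) \<le> q * c" using mult_left_mono[OF 2, of q] q by simp
      also have "\<dots> \<le> (p - l) * a" by (fact W)
      also have "\<dots> \<le> (p - l) * (r * a)" using 1 pl by (simp add: mult_left_mono)
      finally have 3: "q * (c / r) \<le> (p - l) * (r * a)" .
      have 4: "r * a \<le> r * ?M" using W r by simp
      have "ev X' P' (g # w) = Mat2 (r * a) (r * b) (c / r) (d / r)"
        by (simp add: GB W(1)) (simp add: P'_def)
      moreover have "1 \<le> r * a" using 1 W(6) by linarith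
      ultimately show ?thesis using GB 3 4 W r
        by (simp add: mult.left_commute mult_nonneg_nonpos)
    qed
  qed
  then obtain a b c d where W: "ev X' P' w = Mat2 a b c d" "a * d - b * c = 1" "b \<le> 0" "0 \<le> c"
      "1 \<le> a" "a \<le> p ^ count_list w GA * r ^ count_list w GB"
    by meson
  have "b * c \<le> 0" using W by (simp add: mult_nonpos_nonneg)
  then have "d \<le> 1 / a" using W by (simp add: field_simps)
  with W that[of a] tr show thesis by simp
qed

text \<open>\<open>e\<close> is a reference growth per original letter; \<open>a\<close> and
  \<open>b\<close> are the lengths of the words that \<open>X\<close> and \<open>P\<close> stand
  for, so \<open>n\<close> is the total length. Condition \<open>T\<close> amounts to
  \<open>p * (x - p) < 1\<close>, and the last two parts of \<open>x\<close> give
  \<open>p \<le> x\<close> and \<open>x \<le> 2 * p\<close>.\<close>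

lemma tr2_ev_less:
  fixes a b :: nat
  assumes det: "det2 X = 1" "det2 P = 1"
    and r: "1 < r" "tr2 P = r + 1 / r"
    and tr: "tr2 X = x" "tr2 (X * P) = x * (r + 1 / r) - y"
    and T: "0 < (r + 1 / r)\<^sup>2 - x * y * (r + 1 / r) + x\<^sup>2 + y\<^sup>2 - 4"
    and x: "2 \<le> x" "x \<le> y * r" "2 * y \<le> x * (r + 1 / r)"
    and e: "(x * r - y) / (r - 1 / r) < e ^ a" "r \<le> e ^ b" "0 < e"
    and w: "0 < count_list w GA \<or> w \<noteq> [] \<and> r < e ^ b"
    and n: "n = a * count_list w GA + b * count_list w GB"
  shows "tr2 (ev X P w) < e ^ n + 1 / e ^ n"
proof -
  define D where "D = r - 1 / r"
  define p where "p = (x * r - y) / D"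
  have D: "0 < D" "D\<^sup>2 = (r + 1 / r)\<^sup>2 - 4"
    using r by (simp_all add: D_def field_simps power2_eq_square less_1_mult)
  have pD1: "p * D = x * r - y" using D(1) by (simp add: p_def)
  have "(x - p) * D = x * (r - 1 / r) - p * D" by (simp add: D_def left_diff_distrib)
  then have pD: "p * D = x * r - y" "(x - p) * D = y - x / r"
    unfolding pD1 by (simp_all add: right_diff_distrib)
  have "p * (x - p) * D\<^sup>2 = (p * D) * ((x - p) * D)" by (simp add: power2_eq_square)
  also have "\<dots> = x * y * (r + 1 / r) - x\<^sup>2 - y\<^sup>2"
    unfolding pD using r by (simp add: field_simps power2_eq_square)
  also have "\<dots> < D\<^sup>2" using T D by simp
  finally have pt: "p * (x - p) < 1" using D(1) by simp
  have "0 \<le> (x - p) * D" unfolding pD using x r by (simp add: field_simps)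
  then have px: "p \<le> x" using D(1) by (simp add: zero_le_mult_iff)
  have "0 \<le> (p - (x - p)) * D"
    unfolding left_diff_distrib[of p] pD using x(3) by (simp add: algebra_simps)
  then have xp: "x \<le> 2 * p" using D(1) by (simp add: zero_le_mult_iff)
  have pX: "p * (r - 1 / r) = tr2 (X * P) - tr2 X / r"
    using pD(1) by (simp add: tr D_def algebra_simps)
  obtain m where m: "1 \<le> m" "m \<le> p ^ count_list w GA * r ^ count_list w GB"
    "tr2 (ev X P w) \<le> m + 1 / m"
    by (rule tr2_ev_le[OF det r pX, of w]) (use pt px xp x tr in simp_all)
  have p1: "1 \<le> p" "p < e ^ a" using xp x(1) e(1) by (linarith, simp add: p_def D_def)
  have n': "e ^ n = (e ^ a) ^ count_list w GA * (e ^ b) ^ count_list w GB"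
    by (simp add: n power_add power_mult)
  have "p ^ count_list w GA * r ^ count_list w GB < e ^ n"
  proof (cases "0 < count_list w GA")
    case True
    have "p ^ count_list w GA < (e ^ a) ^ count_list w GA"
      using p1 True by (intro power_strict_mono) auto
    moreover have "r ^ count_list w GB \<le> (e ^ b) ^ count_list w GB"
      using e r by (intro power_mono) auto
    ultimately show ?thesis unfolding n' using r p1
      by (intro mult_less_le_imp_less) auto
  next
    case False
    with w have "w \<noteq> []" "r < e ^ b" by auto
    moreover have "length w = count_list w GB"
    proof -
      have "length w = count_list w GA + count_list w GB" for w
      proof (induction w)
        case (Cons g w)
        then show ?case by (cases g) simp_all
      qed simp
      then show ?thesis using False by simp
    qed
    ultimately have "r ^ count_list w GB < (e ^ b) ^ count_list w GB"
      using r by (intro power_strict_mono) (auto simp: length_greater_0_conv[symmetric])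
    then show ?thesis using False by (simp add: n')
  qed
  with m have "m + 1 / m < e ^ n + 1 / e ^ n"
    by (intro add_inverse_strict_mono) auto
  with m show ?thesis by simp
qed

fun flip_gen :: "gen \<Rightarrow> gen" where "flip_gen GA = GB" | "flip_gen GB = GA"

lemma ev_flip: "ev X Y (map flip_gen w) = ev Y X w"
  by (induction Y X w rule: ev.induct) simp_all

lemma count_list_flip:
  "count_list (map flip_gen w) GA = count_list w GB" "count_list (map flip_gen w) GB = count_list w GA"
proof (induction w)
  case (Cons g w)
  { case 1 show ?case using Cons by (cases g) simp_all }
  { case 2 show ?case using Cons by (cases g) simp_all }
qed simp_all

lemma wpow_Suc: "wpow w (Suc n) = w @ wpow w n" and wpow_0: "wpow w 0 = []"
  by (simp_all add: wpow_def)

lemma length_wpow: "length (wpow w n) = n * length w"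
  by (induction n) (simp_all add: wpow_0 wpow_Suc)

lemma sub_a_eq_wpow: "count_list w GA = 0 \<Longrightarrow> sub_a w = wpow [GA, GB] (count_list w GB)"
  by (induction w rule: sub_a.induct) (simp_all add: wpow_0 wpow_Suc)

lemma sub_b_eq_wpow: "count_list w GB = 0 \<Longrightarrow> sub_b w = wpow [GA, GB] (count_list w GA)"
  by (induction w rule: sub_b.induct) (simp_all add: wpow_0 wpow_Suc)

lemma sub_b_wpow: "sub_b (wpow [GA, GB] n) = wpow [GA, GB, GB] n"
  by (induction n) (simp_all add: wpow_0 wpow_Suc)

lemma count_list_sub_a:
  "count_list (sub_a w) GA = count_list w GA + count_list w GB" "count_list (sub_a w) GB = count_list w GB"
  by (induction w rule: sub_a.induct) simp_all

lemma count_list_sub_b: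
  "count_list (sub_b w) GA = count_list w GA" "count_list (sub_b w) GB = count_list w GA + count_list w GB"
  by (induction w rule: sub_b.induct) simp_all

lemma tr2_ev_wpow:
  assumes "det2 X = 1" "det2 Y = 1" "tr2 (ev X Y v) = r + 1 / r" "0 < r"
  shows "tr2 (ev X Y (wpow v n)) = r ^ n + 1 / r ^ n"
proof (induction n rule: induct_nat_012)
  case (ge2 n)
  have "tr2 (ev X Y (wpow v (Suc (Suc n))))
    = (r + 1 / r) * tr2 (ev X Y (wpow v (Suc n))) - tr2 (ev X Y (wpow v n))"
    using assms by (simp add: wpow_Suc ev_append tr2_square_mult det2_ev)
  moreover have "(r + 1 / r) * (r * s + 1 / (r * s)) - (s + 1 / s) = r * r * s + 1 / (r * r * s)"
    if "0 < s" for s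
    using that assms(4) by (simp add: field_simps)
  ultimately show ?case using assms(4) ge2 by (simp add: mult.assoc)
qed (simp_all add: wpow_0 wpow_Suc assms)

section \<open>Words of maximal trace in lengths 2n and 3n\<close>

section \<open>Words of maximal trace\<close>

definition max_word :: "mat2 \<Rightarrow> mat2 \<Rightarrow> gen list \<Rightarrow> bool" where
  "max_word X Y w \<longleftrightarrow> (\<forall>u. length u = length w \<longrightarrow> tr2 (ev X Y u) \<le> tr2 (ev X Y w))"

lemma max_word_rotation: "rotation_of u w \<Longrightarrow> max_word X Y w \<Longrightarrow> max_word X Y u"
  unfolding max_word_def using rotation_of_length tr2_ev_rotation by metis

lemma max_word_not_unbalanced:
  assumes "pos_pair X Y" "max_word X Y w"
  shows "\<not> rotation_of (GA # s @ [GB, GB] @ t @ [GA]) w"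
proof
  assume "rotation_of (GA # s @ [GB, GB] @ t @ [GA]) w"
  then have "max_word X Y (GA # s @ [GB, GB] @ t @ [GA])"
    using assms(2) max_word_rotation by blast
  then have "tr2 (ev X Y (GB # rev s @ [GA, GB] @ t @ [GA])) \<le> tr2 (ev X Y (GA # s @ [GB, GB] @ t @ [GA]))"
    unfolding max_word_def by (rule allE) (erule mp, simp)
  with tr2_ev_reverse_factor_less[OF assms(1), of s t] show False by simp
qed

text \<open>The polynomial is Fricke's expression for the trace of the group commutator, minus 2.
  The claim is the case of the empty word in \<open>pos_pair\<close>.\<close>

lemma pos_pair_fricke:
  assumes "pos_pair X Y"
  shows "0 < (tr2 (X * Y))\<^sup>2 - tr2 X * tr2 Y * tr2 (X * Y) + (tr2 X)\<^sup>2 + (tr2 Y)\<^sup>2 - 4"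
proof -
  have det: "det2 X = 1" "det2 Y = 1" and pos: "0 < tr2 (ev X Y [] * (Y * comm2 X Y * X))"
    using assms unfolding pos_pair_def by blast+
  have "Y * comm2 X Y * X = sc (tr2 (X * Y) - tr2 X * tr2 Y) * (Y * X) + X * X + Y * Y"
    by (rule pos_pair_comm2[OF det])
  with pos show ?thesis
    by (simp add: tr2_add tr2_sc tr2_square det tr2_mult_commute[of Y X] algebra_simps power2_eq_square)
qed

lemma tr2_ev_sub_a_less:
  assumes "pos_pair X Y" "1 < r" "tr2 (X * Y) = r + 1 / r"
    and "2 \<le> tr2 X" "tr2 X \<le> tr2 Y * r" "2 * tr2 Y \<le> tr2 X * (r + 1 / r)"
    and "(tr2 X * r - tr2 Y) / (r - 1 / r) < e ^ a" "r \<le> e ^ b" "0 < e"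
    and "0 < count_list w GA \<or> w \<noteq> [] \<and> r < e ^ b"
    and "n = a * count_list w GA + b * count_list w GB"
  shows "tr2 (ev X (X * Y) w) < e ^ n + 1 / e ^ n"
proof -
  have det: "det2 X = 1" "det2 (X * Y) = 1"
    using assms(1) by (simp_all add: pos_pair_def det2_mult)
  show ?thesis
    by (rule tr2_ev_less[where r = r and a = a and b = b and x = "tr2 X" and y = "tr2 Y"])
      (use assms det pos_pair_fricke[OF assms(1)] in \<open>simp_all add: tr2_square_mult\<close>)
qed

lemma tr2_ev_sub_b_less:
  assumes "pos_pair X Y" "1 < r" "tr2 (X * Y) = r + 1 / r"
    and "2 \<le> tr2 Y" "tr2 Y \<le> tr2 X * r" "2 * tr2 X \<le> tr2 Y * (r + 1 / r)"
    and "(tr2 Y * r - tr2 X) / (r - 1 / r) < e ^ a" "r \<le> e ^ b" "0 < e"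
    and "0 < count_list w GB"
    and "n = a * count_list w GB + b * count_list w GA"
  shows "tr2 (ev (X * Y) Y w) < e ^ n + 1 / e ^ n"
proof -
  have det: "det2 X = 1" "det2 Y = 1" "det2 (X * Y) = 1"
    using assms(1) by (simp_all add: pos_pair_def det2_mult)
  have "tr2 (Y * (X * Y)) = tr2 (Y * (Y * X))"
    using tr2_mult_commute[of "Y * X" Y] by (simp add: mult.assoc)
  then have tr: "tr2 (Y * (X * Y)) = tr2 Y * tr2 (X * Y) - tr2 X"
    using det by (simp add: tr2_square_mult tr2_mult_commute[of Y X])
  have "tr2 (ev Y (X * Y) (map flip_gen w)) < e ^ n + 1 / e ^ n"
    by (rule tr2_ev_less[where r = r and a = a and b = b and x = "tr2 Y" and y = "tr2 X"])
      (use assms det tr pos_pair_fricke[OF assms(1)] in \<open>simp_all add: count_list_flip algebra_simps\<close>)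
  then show ?thesis by (simp add: ev_flip)
qed

text \<open>In either regrouping a letter outside \<open>ab\<close> contributes a factor below
  \<open>sqrt r\<close>, the growth of \<open>ab\<close> per letter; a single such letter already
  brings the trace below that of the power of \<open>ab\<close>.\<close>

lemma max_word_ab:
  assumes pos: "pos_pair X Y" and r: "1 < r" "tr2 (X * Y) = r + 1 / r"
    and x: "2 \<le> tr2 X" "tr2 X \<le> tr2 Y * r" "2 * tr2 Y \<le> tr2 X * (r + 1 / r)"
    and y: "2 \<le> tr2 Y" "tr2 Y \<le> tr2 X * r" "2 * tr2 X \<le> tr2 Y * (r + 1 / r)"
    and px: "(tr2 X * r - tr2 Y) / (r - 1 / r) < sqrt r"
    and py: "(tr2 Y * r - tr2 X) / (r - 1 / r) < sqrt r"
    and w: "length w = 2 * n" "max_word X Y w"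
  shows "rotation_of w (wpow [GA, GB] n)"
proof -
  have det: "det2 X = 1" "det2 Y = 1" using pos by (simp_all add: pos_pair_def)
  have e: "0 < sqrt r" "sqrt r ^ 2 = r" "sqrt r ^ (2 * n) = r ^ n"
    using r by (simp_all add: power_mult)
  have "tr2 (ev X Y (wpow [GA, GB] n)) = r ^ n + 1 / r ^ n"
    using r det by (intro tr2_ev_wpow) simp_all
  moreover have "tr2 (ev X Y (wpow [GA, GB] n)) \<le> tr2 (ev X Y w)"
    using w by (simp add: max_word_def length_wpow)
  ultimately have ge: "r ^ n + 1 / r ^ n \<le> tr2 (ev X Y w)" by simp
  show ?thesis
  proof (cases w rule: rotation_cases)
    case (sub_a u)
    have n: "2 * n = 1 * count_list u GA + 2 * count_list u GB"
      using rotation_of_length[OF sub_a] w by (simp add: length_sub_a)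
    have "count_list u GA = 0"
    proof (rule ccontr)
      assume "count_list u GA \<noteq> 0"
      then have "tr2 (ev X (X * Y) u) < sqrt r ^ (2 * n) + 1 / sqrt r ^ (2 * n)"
        by (intro tr2_ev_sub_a_less[OF pos r x _ _ e(1) _ n]) (use px e in simp_all)
      with ge tr2_ev_rotation[OF sub_a, of X Y] show False by (simp add: ev_sub_a e)
    qed
    with n sub_a_eq_wpow[of u] have "sub_a u = wpow [GA, GB] n" by simp
    with sub_a show ?thesis by (simp add: rotation_of_sym)
  next
    case (sub_b u)
    have n: "2 * n = 1 * count_list u GB + 2 * count_list u GA"
      using rotation_of_length[OF sub_b] w by (simp add: length_sub_b)
    have "count_list u GB = 0"
    proof (rule ccontr)
      assume "count_list u GB \<noteq> 0"
      then have "tr2 (ev (X * Y) Y u) < sqrt r ^ (2 * n) + 1 / sqrt r ^ (2 * n)"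
        by (intro tr2_ev_sub_b_less[OF pos r y _ _ e(1) _ n]) (use py e in simp_all)
      with ge tr2_ev_rotation[OF sub_b, of X Y] show False by (simp add: ev_sub_b e)
    qed
    with n sub_b_eq_wpow[of u] have "sub_b u = wpow [GA, GB] n" by simp
    with sub_b show ?thesis by (simp add: rotation_of_sym)
  next
    case (unbalanced s t)
    with max_word_not_unbalanced[OF pos w(2)] show ?thesis by blast
  qed
qed

text \<open>Words in \<open>a, ab\<close> lose outright, since these letters grow by less than their
  shares \<open>e\<close> and \<open>e^2\<close>. Words in \<open>b, ab\<close> are words in the
  pair \<open>Z, Y\<close>, to which the same three cases are applied again.\<close>

lemma max_word_abb:
  fixes X Y defines "Z \<equiv> X * Y"
  assumes pos: "pos_pair X Y"
    and q: "1 < q" "tr2 Z = q + 1 / q" and r: "1 < r" "tr2 (Z * Y) = r + 1 / r"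
    and x: "2 \<le> tr2 X" "tr2 X \<le> tr2 Y * q" "2 * tr2 Y \<le> tr2 X * (q + 1 / q)"
    and y: "2 \<le> tr2 Y" "tr2 Y \<le> tr2 Z * r" "2 * tr2 Z \<le> tr2 Y * (r + 1 / r)"
    and z: "2 \<le> tr2 Z" "tr2 Z \<le> tr2 Y * r" "2 * tr2 Y \<le> tr2 Z * (r + 1 / r)"
    and e: "0 < e" "e ^ 3 = r" "q < e\<^sup>2"
    and px: "(tr2 X * q - tr2 Y) / (q - 1 / q) < e"
    and py: "(tr2 Y * r - tr2 Z) / (r - 1 / r) < e"
    and pz: "(tr2 Z * r - tr2 Y) / (r - 1 / r) < e\<^sup>2"
    and n: "0 < n" and w: "length w = 3 * n" "max_word X Y w"
  shows "rotation_of w (wpow [GA, GB, GB] n)"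
proof -
  have det: "det2 X = 1" "det2 Y = 1" using pos by (simp_all add: pos_pair_def)
  have en: "e ^ (3 * n) = r ^ n" using e(2) by (simp add: power_mult)
  have pos': "pos_pair Z Y" using pos_pair_mult[OF pos] by (simp add: Z_def)
  have "tr2 (ev X Y (wpow [GA, GB, GB] n)) = r ^ n + 1 / r ^ n"
    using r det by (intro tr2_ev_wpow) (simp_all add: Z_def mult.assoc)
  moreover have "tr2 (ev X Y (wpow [GA, GB, GB] n)) \<le> tr2 (ev X Y w)"
    using w by (simp add: max_word_def length_wpow)
  ultimately have ge: "r ^ n + 1 / r ^ n \<le> tr2 (ev X Y w)" by simp
  show ?thesis
  proof (cases w rule: rotation_cases)
    case (sub_a u)
    have n': "3 * n = 1 * count_list u GA + 2 * count_list u GB"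
      using rotation_of_length[OF sub_a] w by (simp add: length_sub_a)
    have "tr2 (ev X (X * Y) u) < e ^ (3 * n) + 1 / e ^ (3 * n)"
      by (rule tr2_ev_sub_a_less[OF pos q(1) _ x _ _ e(1) _ n']) (use q px e n n' in \<open>auto simp: Z_def\<close>)
    with ge tr2_ev_rotation[OF sub_a, of X Y] show ?thesis by (simp add: ev_sub_a en)
  next
    case (sub_b v)
    have v: "tr2 (ev X Y w) = tr2 (ev Z Y v)"
      using tr2_ev_rotation[OF sub_b, of X Y] by (simp add: ev_sub_b Z_def)
    have nv: "3 * n = 2 * count_list v GA + count_list v GB"
      using rotation_of_length[OF sub_b] w by (simp add: length_sub_b)
    have "rotation_of v (wpow [GA, GB] n)"
    proof (cases v rule: rotation_cases)
      case (sub_a u)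
      have n': "3 * n = 2 * count_list u GA + 3 * count_list u GB"
        using nv by (simp add: count_list_sub_a flip: rotation_of_count_list[OF sub_a])
      have "count_list u GA = 0"
      proof (rule ccontr)
        assume "count_list u GA \<noteq> 0"
        then have "tr2 (ev Z (Z * Y) u) < e ^ (3 * n) + 1 / e ^ (3 * n)"
          by (intro tr2_ev_sub_a_less[OF pos' r z _ _ e(1) _ n']) (use pz e in simp_all)
        with ge v tr2_ev_rotation[OF sub_a, of Z Y] show False by (simp add: ev_sub_a en)
      qed
      with n' sub_a_eq_wpow[of u] have "sub_a u = wpow [GA, GB] n" by simp
      with sub_a show ?thesis by (simp add: rotation_of_sym)
    next
      case (sub_b u)
      have n': "3 * n = 1 * count_list u GB + 3 * count_list u GA"
        using nv by (simp add: count_list_sub_b flip: rotation_of_count_list[OF sub_b])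
      have "count_list u GB = 0"
      proof (rule ccontr)
        assume "count_list u GB \<noteq> 0"
        then have "tr2 (ev (Z * Y) Y u) < e ^ (3 * n) + 1 / e ^ (3 * n)"
          by (intro tr2_ev_sub_b_less[OF pos' r y _ _ e(1) _ n']) (use py e in simp_all)
        with ge v tr2_ev_rotation[OF sub_b, of Z Y] show False by (simp add: ev_sub_b en)
      qed
      with n' sub_b_eq_wpow[of u] have "sub_b u = wpow [GA, GB] n" by simp
      with sub_b show ?thesis by (simp add: rotation_of_sym)
    next
      case (unbalanced s t)
      \<comment> \<open>Maximality is known for \<open>w\<close>, not for \<open>v\<close> among
        words of its length. Reversal keeps both letter counts, hence the length after
        \<open>sub_b\<close>, so the comparison is still available.\<close>
      define v' where "v' = GB # rev s @ [GA, GB] @ t @ [GA]"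
      have "count_list v' g = count_list v g" for g
        using rotation_of_count_list[OF unbalanced, of g] by (cases g) (simp_all add: v'_def)
      then have "length (sub_b v') = length w"
        using nv w by (simp add: length_sub_b)
      with w(2) have "tr2 (ev Z Y v') \<le> tr2 (ev Z Y v)"
        unfolding max_word_def v Z_def by (metis ev_sub_b)
      moreover have "tr2 (ev Z Y v) < tr2 (ev Z Y v')"
        using tr2_ev_reverse_factor_less[OF pos', of s t] tr2_ev_rotation[OF unbalanced, of Z Y]
        by (simp add: v'_def)
      ultimately show ?thesis by simp
    qed
    then have "rotation_of (sub_b v) (wpow [GA, GB, GB] n)"
      using rotation_of_sub_b sub_b_wpow by metis
    then show ?thesis
      using sub_b rotation_of_sym rotation_of_trans by blast
  next
    case (unbalanced s t)
    with max_word_not_unbalanced[OF pos w(2)] show ?thesis by blast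
  qed
qed

section \<open>Passage from integer to real matrices\<close>

section \<open>Integer matrices\<close>

definition mat2_of :: "imat \<Rightarrow> mat2" where
  "mat2_of A = Mat2 (real_of_int (A$1$1)) (real_of_int (A$1$2)) (real_of_int (A$2$1)) (real_of_int (A$2$2))"

lemma mat2_of_mult: "mat2_of (A ** B) = mat2_of A * mat2_of B"
  by (simp add: mat2_of_def matrix_matrix_mult_def sum_2)

lemma mat2_of_one: "mat2_of (mat 1) = 1"
  by (simp add: mat2_of_def one_mat2_def mat_def)

lemma tr2_mat2_of: "tr2 (mat2_of A) = real_of_int (trace A)"
  by (simp add: mat2_of_def trace_def sum_2)

lemma det2_mat2_of: "det2 (mat2_of A) = real_of_int (det A)"
  by (simp add: mat2_of_def det_2)

lemma mat2_of_phi: "mat2_of (phi A B w) = ev (mat2_of A) (mat2_of B) w"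
proof (induction w)
  case (Cons g w)
  then show ?case by (cases g) (simp_all add: phi_def mat2_of_mult)
qed (simp add: phi_def mat2_of_one)

lemma wtr_eq: "real_of_int (wtr A B w) = tr2 (ev (mat2_of A) (mat2_of B) w)"
  by (simp add: wtr_def flip: tr2_mat2_of mat2_of_phi)

lemma SL2_nonneg_mult:
  assumes "SL2_nonneg A" "SL2_nonneg B"
  shows "SL2_nonneg (A ** B)"
proof -
  have "det (A ** B) = 1" using assms by (simp add: SL2_nonneg_def det_mul)
  moreover have "\<forall>i j. 0 \<le> (A ** B)$i$j"
    using assms by (simp add: SL2_nonneg_def matrix_matrix_mult_def sum_nonneg)
  ultimately show ?thesis by (simp add: SL2_nonneg_def)
qed

lemma SL2_nonneg_phi: "SL2_nonneg A \<Longrightarrow> SL2_nonneg B \<Longrightarrow> SL2_nonneg (phi A B w)"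
proof (induction w)
  case Nil
  have "\<forall>i j. 0 \<le> (mat 1 :: imat)$i$j" by (simp add: mat_def)
  then show ?case by (simp add: phi_def SL2_nonneg_def)
next
  case (Cons g w)
  then show ?case by (cases g) (simp_all add: phi_def SL2_nonneg_mult)
qed

lemma SL2_nonneg_trace:
  assumes "SL2_nonneg A"
  shows "2 \<le> trace A"
proof -
  let ?a = "A$1$1" and ?d = "A$2$2"
  have nn: "0 \<le> ?a" "0 \<le> ?d" "0 \<le> A$1$2 * A$2$1"
    using assms by (simp_all add: SL2_nonneg_def)
  moreover have "?a * ?d = 1 + A$1$2 * A$2$1"
    using assms by (simp add: SL2_nonneg_def det_2)
  ultimately have "0 < ?a * ?d" by simp
  with nn have "0 < ?a" "0 < ?d" by (auto simp: zero_less_mult_iff)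
  then show ?thesis by (simp add: trace_def sum_2)
qed

section \<open>From maximal trace in each length to optimal words\<close>

section \<open>Optimal words\<close>

lemma count_list_wpow: "count_list (wpow w n) x = n * count_list w x"
  by (induction n) (simp_all add: wpow_0 wpow_Suc)

lemma wpow_add: "wpow w (m + n) = wpow w m @ wpow w n"
  by (induction m) (simp_all add: wpow_0 wpow_Suc)

lemma rotate_wpow: "rotate k (wpow w n) = wpow (rotate k w) n"
proof (induction k)
  case (Suc k)
  have "rotate1 (wpow u n) = wpow (rotate1 u) n" for u :: "gen list"
  proof (cases u)
    case (Cons g s)
    have "wpow (g # s) n @ [g] = g # wpow (s @ [g]) n"
      by (induction n) (simp_all add: wpow_0 wpow_Suc)
    then show ?thesis using Cons by (cases n) (simp_all add: wpow_0 wpow_Suc)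
  qed (simp add: wpow_def)
  with Suc show ?case by simp
qed simp

text \<open>Comparison with \<open>v\<close> involves only lengths divisible by
  \<open>length v\<close>. In each of these a trace maximiser exists by finiteness, and
  \<open>max\<close> makes it a rotation of a power of \<open>v\<close>.\<close>

lemma complete_optimalI:
  assumes v: "lyndon v" "count_list v GA = 1"
    and max: "\<And>n w. 0 < n \<Longrightarrow> length w = length v * n \<Longrightarrow> max_word (mat2_of A) (mat2_of B) w
      \<Longrightarrow> rotation_of w (wpow v n)"
  shows "complete_optimal A B {v}"
proof -
  let ?m = "length v" let ?X = "mat2_of A" and ?Y = "mat2_of B"
  have m: "0 < ?m" using v by (auto simp: lyndon_def)
  have max_v: "max_word ?X ?Y (wpow v n)" if "0 < n" for n
  proof -
    let ?S = "{w :: gen list. length w = ?m * n}"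
    have "(UNIV :: gen set) = {GA, GB}"
      using gen.exhaust by auto
    then have "finite (UNIV :: gen set)" by (metis finite.emptyI finite.insertI)
    then have "finite ?S"
      using finite_lists_length_eq[of UNIV "?m * n"] by simp
    moreover have "?S \<noteq> {}" using Ex_list_of_length[of "?m * n"] by blast
    ultimately obtain w where w: "w \<in> ?S" "\<And>u. u \<in> ?S \<Longrightarrow> tr2 (ev ?X ?Y u) \<le> tr2 (ev ?X ?Y w)"
      using obtains_MAX[of ?S "\<lambda>w. tr2 (ev ?X ?Y w)"] Max_ge
      by (metis (no_types, lifting) finite_imageI image_eqI)
    then have "max_word ?X ?Y w" by (simp add: max_word_def)
    with max[OF that, of w] w max_word_rotation rotation_of_sym show ?thesis by blast
  qed
  have "maximal_word A B v"
    unfolding maximal_word_def wle_def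
  proof (intro conjI allI impI)
    show "v \<noteq> []" using m by auto
    fix u :: "gen list" assume "u \<noteq> []"
    then have "tr2 (ev ?X ?Y (wpow u ?m)) \<le> tr2 (ev ?X ?Y (wpow v (length u)))"
      using max_v[of "length u"] by (simp add: max_word_def length_wpow)
    then show "wtr A B (wpow u ?m) \<le> wtr A B (wpow v (length u))"
      by (simp flip: wtr_eq)
  qed
  moreover have "\<exists>k n. n \<ge> 1 \<and> w = wpow (rotate k v) n" if "maximal_word A B w" for w
  proof -
    let ?l = "length w"
    have w: "0 < ?l" using that by (simp add: maximal_word_def)
    have "wtr A B (wpow v ?l) \<le> wtr A B (wpow w ?m)"
      using that m by (simp add: maximal_word_def wle_def)
    then have "tr2 (ev ?X ?Y (wpow v ?l)) \<le> tr2 (ev ?X ?Y (wpow w ?m))"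
      by (simp flip: wtr_eq)
    with max_v[OF w] have "max_word ?X ?Y (wpow w ?m)"
      by (auto simp: max_word_def length_wpow mult.commute intro: order_trans)
    then have rot: "rotation_of (wpow w ?m) (wpow v ?l)"
      using w by (intro max) (simp_all add: length_wpow)
    then obtain k where k: "wpow w ?m = wpow (rotate k v) ?l"
      unfolding rotation_of_def rotate_wpow by blast
    \<comment> \<open>Since \<open>v\<close> has a single \<open>a\<close>, counting
      \<open>a\<close> shows that \<open>length v\<close> divides \<open>length w\<close>, with
      quotient \<open>c\<close>. As a prefix of its own power, \<open>w\<close> is then read off as
      a power of the rotated \<open>v\<close>.\<close>
    define c where "c = count_list w GA"
    have l: "?l = c * ?m"
      using rotation_of_count_list[OF rot, of GA] v(2) by (simp add: count_list_wpow c_def mult.commute)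
    have "w = take ?l (wpow w ?m)"
      using m by (cases ?m) (simp_all add: wpow_Suc)
    also have "\<dots> = take ?l (wpow (rotate k v) (c + (?l - c)))"
    proof -
      have "c + (?l - c) = ?l" using l m by (cases ?m) simp_all
      then show ?thesis by (simp only: k)
    qed
    also have "\<dots> = wpow (rotate k v) c"
      using l by (simp add: wpow_add length_wpow)
    finally show ?thesis using w l by (metis Suc_leI gr_zeroI mult_0 One_nat_def)
  qed
  ultimately show ?thesis using v(1) by (simp add: complete_optimal_def)
qed

section \<open>Inequalities between growth factors\<close>

section \<open>Estimates\<close>

text \<open>Squaring the first claim and reducing by \<open>r^2 = z r - 1\<close> leaves
  \<open>r\<close> times the assumed polynomial plus \<open>y^2 - x^2\<close>. The second factor is
  smaller than the first.\<close>

lemma growth_less_sqrt: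
  fixes x y z r :: real
  assumes "2 \<le> x" "x < y" "0 \<le> z\<^sup>2 - 4 - y\<^sup>2 * z + 2 * x * y" and r: "1 < r" "z = r + 1 / r"
  shows "(y * r - x) / (r - 1 / r) < sqrt r" "(x * r - y) / (r - 1 / r) < sqrt r"
proof -
  define D where "D = r - 1 / r"
  have D: "0 < D" "D\<^sup>2 = z\<^sup>2 - 4"
    using r by (simp_all add: D_def field_simps power2_eq_square less_1_mult)
  have r2: "r\<^sup>2 = z * r - 1" using r by (simp add: field_simps power2_eq_square)
  have "r * D\<^sup>2 - (y * r - x)\<^sup>2 = r * (z\<^sup>2 - 4 - y\<^sup>2 * z + 2 * x * y) + (y\<^sup>2 - x\<^sup>2)"
    using r2 unfolding D by algebra
  moreover have "x\<^sup>2 < y\<^sup>2" using assms by (intro power_strict_mono) auto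
  moreover have "0 \<le> r * (z\<^sup>2 - 4 - y\<^sup>2 * z + 2 * x * y)"
    using assms by (intro mult_nonneg_nonneg) auto
  ultimately have "(y * r - x)\<^sup>2 < (sqrt r * D)\<^sup>2"
    using r(1) by (simp add: power_mult_distrib)
  then have "y * r - x < sqrt r * D"
    by (rule power2_less_imp_less) (use D(1) r(1) in simp)
  then show 1: "(y * r - x) / (r - 1 / r) < sqrt r"
    using D(1) by (simp add: D_def[symmetric] field_simps)
  have "(y - x) * (r + 1) > 0" using assms by simp
  then have "x * r - y \<le> y * r - x" by (simp add: algebra_simps)
  then have "(x * r - y) / (r - 1 / r) \<le> (y * r - x) / (r - 1 / r)"
    using D(1) by (intro divide_right_mono) (simp_all add: D_def)
  with 1 show "(x * r - y) / (r - 1 / r) < sqrt r" by simp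
qed

text \<open>All growth factors are compared with \<open>c = z - 1/(2z)\<close>, which separates \<open>e\<^sup>2\<close>
  (about \<open>z - 1/(4z)\<close> in the worst case \<open>2x = y\<close>) from the others (about \<open>z - 1/z\<close>).\<close>

lemma growth_less_root3:
  fixes x y z q r e :: real
  assumes x: "2 \<le> x" "2 * x \<le> y" and z: "z = y\<^sup>2 - 1"
    and q: "1 < q" "z = q + 1 / q" and r: "1 < r" "y * z - x = r + 1 / r"
    and e: "0 < e" "e ^ 3 = r"
  shows "q < e\<^sup>2" "(x * q - y) / (q - 1 / q) < e"
    "(y * r - z) / (r - 1 / r) < e" "(z * r - y) / (r - 1 / r) < e\<^sup>2"
proof -
  have y4: "4 \<le> y" using x by simp
  have "16 \<le> y\<^sup>2" using power_mono[of 4 y 2] y4 by simp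
  then have z15: "15 \<le> z" by (simp add: z)
  have yz: "4 * z \<le> y * z" using y4 z15 by (intro mult_right_mono) auto
  have zy: "15 * y \<le> y * z" using y4 z15 mult_left_mono[of 15 z y] by (simp add: mult.commute)
  have r1: "0 < 1 / r" "1 / r < 1" using r by simp_all
  have r_less: "r \<le> y * z" using r r1 x by linarith
  have r_ge: "z \<le> r" "y \<le> r" using r r1 x yz zy z15 by linarith+
  define c where "c = z - 1 / (2 * z)"
  have h: "0 < 1 / (2 * z)" "1 / (2 * z) \<le> 1 / 30" using z15 by (simp_all add: field_simps)
  have c0: "0 < c" using h z15 unfolding c_def by linarith
  \<comment> \<open>The target is \<open>(e^2)^3 = r^2\<close>, and \<open>r^2\<close> is at least
    \<open>(r + 1 / r)^2 - 3\<close>, so \<open>c\<close> is compared with that, using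
    \<open>x \<le> y / 2\<close>.\<close>
  have "c ^ 3 \<le> (y * z - x)\<^sup>2 - 3"
  proof -
    have "c ^ 3 = z ^ 3 - 3 / 2 * z + 3 / 2 * (1 / (2 * z)) - (1 / (2 * z)) ^ 3"
      using z15 by (simp add: c_def field_simps power3_eq_cube)
    moreover have "0 < (1 / (2 * z)) ^ 3" using h by simp
    ultimately have "c ^ 3 \<le> z ^ 3 - 3 / 2 * z + 1" using h by linarith
    moreover have "y\<^sup>2 * (z - 1 / 2)\<^sup>2 \<le> (y * z - x)\<^sup>2"
    proof -
      have "(y * (z - 1 / 2))\<^sup>2 \<le> (y * z - x)\<^sup>2"
        using x y4 z15 by (intro power_mono) (simp_all add: algebra_simps)
      then show ?thesis by (simp add: power_mult_distrib)
    qed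
    moreover have "y\<^sup>2 * (z - 1 / 2)\<^sup>2 = z ^ 3 - 3 / 4 * z + 1 / 4"
    proof -
      have "y\<^sup>2 = z + 1" using z by simp
      then show ?thesis by (simp add: field_simps power2_eq_square power3_eq_cube)
    qed
    ultimately show ?thesis using z15 by linarith
  qed
  also have "\<dots> \<le> r\<^sup>2"
  proof -
    have "(1 / r)\<^sup>2 \<le> 1" using r1 by (simp add: power_le_one)
    moreover have "(r + 1 / r)\<^sup>2 = r\<^sup>2 + 2 + (1 / r)\<^sup>2"
      using r by (simp add: power2_sum)
    ultimately show ?thesis using r by simp
  qed
  also have "r\<^sup>2 = (e\<^sup>2) ^ 3" using e(2) by (metis power_mult mult.commute)
  finally have ce: "c \<le> e\<^sup>2"
    using e by (metis power_le_imp_le_base zero_le_power2 Suc_numeral semiring_norm(5))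
  have sq: "s < e" if "s\<^sup>2 < c" for s
    using that ce e by (meson order_less_le_trans less_imp_le power2_less_imp_less)
  have "q < z" using q by simp
  then have "1 / z < 1 / q" using q(1) by (intro divide_strict_left_mono) auto
  moreover have "1 / (2 * z) = (1 / z) / 2" by simp
  ultimately have "q < c" using q(2) h(1) unfolding c_def by linarith
  with ce show "q < e\<^sup>2" by simp
  have Dq: "0 < q - 1 / q" using q by (simp add: less_1_mult field_simps)
  have Dr: "0 < r - 1 / r" using r by (simp add: less_1_mult field_simps)
  have "(x * q - y) / (q - 1 / q) \<le> x"
  proof -
    have "x * (1 / q) \<le> x * 1" using q x by (intro mult_left_mono) auto
    then have "x * q - y \<le> x * (q - 1 / q)" using x by (simp add: right_diff_distrib)
    then show ?thesis using Dq by (simp add: pos_divide_le_eq)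
  qed
  also have "x < e"
  proof (rule sq)
    have "(2 * x)\<^sup>2 \<le> y\<^sup>2" using x by (intro power_mono) auto
    then have "4 * x\<^sup>2 \<le> z + 1" using z by (simp add: power_mult_distrib)
    then show "x\<^sup>2 < c" using h z15 unfolding c_def by linarith
  qed
  finally show "(x * q - y) / (q - 1 / q) < e" .
  \<comment> \<open>As \<open>r \<le> y z\<close>, the correction \<open>3 / (4 * y)\<close> costs
    at most \<open>3/4 z\<close> and leaves \<open>z / 4\<close> to cover \<open>y / r\<close>. It
    lowers the square by about \<open>3/2\<close>, enough to get below \<open>c\<close> since
    \<open>y^2 = z + 1\<close>.\<close>
  have "(y * r - z) / (r - 1 / r) \<le> y - 3 / (4 * y)"
  proof -
    have "3 / (4 * y) * r \<le> 3 / 4 * z" using r_less y4 by (simp add: field_simps)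
    moreover have "y * (1 / r) \<le> 1" using r_ge r by (simp add: field_simps)
    moreover have "0 \<le> 3 / (4 * y) * (1 / r)" using y4 r by simp
    ultimately have "y * r - z \<le> y * r - y * (1 / r) - 3 / (4 * y) * r + 3 / (4 * y) * (1 / r)"
      using z15 by linarith
    also have "\<dots> = (y - 3 / (4 * y)) * (r - 1 / r)" by (simp only: algebra_simps)
    finally show ?thesis using Dr by (simp add: pos_divide_le_eq)
  qed
  also have "\<dots> < e"
  proof (rule sq)
    have "(y - 3 / (4 * y))\<^sup>2 = y\<^sup>2 - 3 / 2 + 9 / 16 * (1 / y\<^sup>2)"
      using y4 by (simp add: field_simps power2_eq_square)
    moreover have "1 / y\<^sup>2 \<le> 1 / 16" using \<open>16 \<le> y\<^sup>2\<close> by (intro divide_left_mono) auto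
    ultimately show "(y - 3 / (4 * y))\<^sup>2 < c" using h unfolding c_def z[symmetric]
      using z by linarith
  qed
  finally show "(y * r - z) / (r - 1 / r) < e" .
  have "z * r - y < c * (r - 1 / r)"
  proof -
    have "z * (1 / r) \<le> 1" using r_ge r by (simp add: field_simps)
    moreover have "1 / (2 * z) * r \<le> 1 / 2 * y" using r_less z15 by (simp add: field_simps)
    moreover have "0 \<le> 1 / (2 * z) * (1 / r)" using h(1) r by simp
    ultimately have "z * r - y < z * r - z * (1 / r) - 1 / (2 * z) * r + 1 / (2 * z) * (1 / r)"
      using y4 by linarith
    also have "\<dots> = c * (r - 1 / r)" unfolding c_def by (simp only: algebra_simps)
    finally show ?thesis .
  qed
  then have "(z * r - y) / (r - 1 / r) < c" using Dr by (simp add: pos_divide_less_eq)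
  with ce show "(z * r - y) / (r - 1 / r) < e\<^sup>2" by simp
qed

text \<open>Here integrality enters: it leaves a gap around \<open>tr((ab)\<^sup>3) = tr((ab\<^sup>2)\<^sup>2)\<close>.\<close>

lemma trace_gap:
  fixes x y z :: int
  assumes "2 \<le> x" "x < y" "y\<^sup>2 - 2 < z"
  shows "(y * z - x)\<^sup>2 - 2 < z ^ 3 - 3 * z \<Longrightarrow> 0 \<le> z\<^sup>2 - 4 - y\<^sup>2 * z + 2 * x * y"
    and "\<not> (y * z - x)\<^sup>2 - 2 < z ^ 3 - 3 * z \<Longrightarrow> z = y\<^sup>2 - 1 \<and> 2 * x \<le> y"
proof -
  have xy: "x * 2 \<le> x * y" "4 \<le> x * y" "x\<^sup>2 < y\<^sup>2"
  proof -
    show "x * 2 \<le> x * y" using assms by (intro mult_left_mono) auto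
    then show "4 \<le> x * y" using assms by linarith
    show "x\<^sup>2 < y\<^sup>2" using assms by (intro power_strict_mono) auto
  qed
  have x2: "4 \<le> x\<^sup>2" using power_mono[of 2 x 2] assms by simp
  have z0: "0 < z" using assms xy x2 by linarith
  have big: "0 \<le> z\<^sup>2 - 4 - y\<^sup>2 * z + 2 * x * y \<and> (y * z - x)\<^sup>2 - 2 < z ^ 3 - 3 * z" if "y\<^sup>2 \<le> z"
  proof -
    have "0 \<le> z * (z - y\<^sup>2)" using that z0 by simp
    then have 1: "0 \<le> z\<^sup>2 - y\<^sup>2 * z" by (simp add: algebra_simps power2_eq_square)
    have "z ^ 3 - 3 * z - ((y * z - x)\<^sup>2 - 2)
      = z * (z\<^sup>2 - y\<^sup>2 * z) + (2 * (x * y) - 4) * z + (z - x\<^sup>2) + 2"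
      by (simp add: algebra_simps power2_eq_square power3_eq_cube)
    moreover have "0 \<le> z * (z\<^sup>2 - y\<^sup>2 * z)" "0 \<le> (2 * (x * y) - 4) * z"
      using 1 z0 xy by simp_all
    ultimately show ?thesis using 1 that xy by simp
  qed
  \<comment> \<open>By integrality \<open>z = y^2 - 1\<close> is the only case outside
    \<open>big\<close>. There both differences are governed by the sign of the integer
    \<open>m\<close>, and \<open>m < 0\<close> means \<open>m \<le> - 1\<close>.\<close>
  define m where "m = y\<^sup>2 - 2 * x * y + 2"
  have small: "z\<^sup>2 - 4 - y\<^sup>2 * z + 2 * x * y = - 1 - m
      \<and> z ^ 3 - 3 * z - ((y * z - x)\<^sup>2 - 2) = 2 - x\<^sup>2 - z * m" if "z = y\<^sup>2 - 1"
    unfolding m_def that by (simp add: algebra_simps power2_eq_square power3_eq_cube)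
  have cases: "y\<^sup>2 \<le> z \<or> z = y\<^sup>2 - 1" using assms by linarith
  show "0 \<le> z\<^sup>2 - 4 - y\<^sup>2 * z + 2 * x * y" if "(y * z - x)\<^sup>2 - 2 < z ^ 3 - 3 * z"
  proof (cases "y\<^sup>2 \<le> z")
    case False
    then have s: "z = y\<^sup>2 - 1" using cases by blast
    have "m < 0"
    proof (rule ccontr)
      assume "\<not> m < 0"
      then have "0 \<le> z * m" using z0 by simp
      with small[OF s] that x2 show False by linarith
    qed
    with small[OF s] show ?thesis by linarith
  qed (use big in blast)
  show "z = y\<^sup>2 - 1 \<and> 2 * x \<le> y" if "\<not> (y * z - x)\<^sup>2 - 2 < z ^ 3 - 3 * z"
  proof
    show s: "z = y\<^sup>2 - 1" using big cases that by blast
    have "0 \<le> m"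
    proof (rule ccontr)
      assume "\<not> 0 \<le> m"
      then have "z * m \<le> z * (- 1)" using z0 by (intro mult_left_mono) auto
      with small[OF s] that xy s show False by linarith
    qed
    show "2 * x \<le> y"
    proof (rule ccontr)
      assume "\<not> 2 * x \<le> y"
      then have "(y + 1) * y \<le> 2 * x * y" using assms by (intro mult_right_mono) auto
      then have "y\<^sup>2 + y \<le> 2 * x * y" by (simp add: algebra_simps power2_eq_square)
      with \<open>0 \<le> m\<close> assms show False by (simp add: m_def)
    qed
  qed
qed

section \<open>Traces of the given pair and the choice between ab and ab^2\<close>

theorem theorem7p5:
  fixes A B :: "int^2^2"
  assumes "SL2_nonneg A" and "SL2_nonneg B"
    and "A ** B \<noteq> B ** A"
    and "well_oriented A B"
    and "trace A < trace B"
    and "trace (A ** B) > trace (B ** B)"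
  shows "(trace ((A ** B) ** (A ** B) ** (A ** B)) > trace ((A ** B ** B) ** (A ** B ** B))
            \<longrightarrow> complete_optimal A B {[GA, GB]})
       \<and> (\<not> trace ((A ** B) ** (A ** B) ** (A ** B)) > trace ((A ** B ** B) ** (A ** B ** B))
            \<longrightarrow> complete_optimal A B {[GA, GB, GB]})"
proof -
  define X Y where "X = mat2_of A" and "Y = mat2_of B"
  define x y z where "x = trace A" and "y = trace B" and "z = trace (A ** B)"
  have tr: "tr2 X = real_of_int x" "tr2 Y = real_of_int y" "tr2 (X * Y) = real_of_int z"
    by (simp_all add: X_def Y_def x_def y_def z_def tr2_mat2_of flip: mat2_of_mult)
  have det: "det2 X = 1" "det2 Y = 1" "det2 (X * Y) = 1" "det2 (X * Y * Y) = 1"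
    using assms by (simp_all add: X_def Y_def det2_mat2_of SL2_nonneg_def det2_mult)
  have D: "tr2 (X * Y * Y) = real_of_int y * real_of_int z - real_of_int x"
  proof -
    have "tr2 (X * Y * Y) = tr2 (Y * (Y * X))"
      using tr2_mult_commute[of X "Y * Y"] by (simp add: mult.assoc)
    then show ?thesis using det tr by (simp add: tr2_square_mult tr2_mult_commute[of Y X])
  qed
  have "real_of_int (trace (B ** B)) = (real_of_int y)\<^sup>2 - 2"
    using det tr by (simp add: tr2_square mat2_of_mult flip: tr2_mat2_of Y_def)
  then have BB: "trace (B ** B) = y\<^sup>2 - 2"
    by (metis of_int_diff of_int_eq_iff of_int_numeral of_int_power)
  define C where "C = X * Y"
  have "tr2 (C * C * C) = real_of_int (z ^ 3 - 3 * z)"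
    using tr2_square_mult[of C C] det(3) tr(3)
    by (simp add: C_def[symmetric] mult.assoc tr2_square power2_eq_square power3_eq_cube algebra_simps)
  then have "real_of_int (trace ((A ** B) ** (A ** B) ** (A ** B))) = real_of_int (z ^ 3 - 3 * z)"
    by (simp only: C_def X_def Y_def flip: tr2_mat2_of mat2_of_mult)
  then have C3: "trace ((A ** B) ** (A ** B) ** (A ** B)) = z ^ 3 - 3 * z"
    by (simp only: of_int_eq_iff)
  have "real_of_int (trace ((A ** B ** B) ** (A ** B ** B))) = real_of_int ((y * z - x)\<^sup>2 - 2)"
    using det D by (simp add: tr2_square mat2_of_mult flip: tr2_mat2_of X_def Y_def)
  then have D2: "trace ((A ** B ** B) ** (A ** B ** B)) = (y * z - x)\<^sup>2 - 2"
    by (simp only: of_int_eq_iff)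
  have xyz: "2 \<le> x" "x < y" "y\<^sup>2 - 2 < z"
    using assms BB SL2_nonneg_trace[of A] by (simp_all add: x_def y_def z_def)
  have y3: "3 \<le> y" using xyz by simp
  have yy: "y * 3 \<le> y\<^sup>2" using mult_left_mono[of 3 y y] y3 by (simp add: power2_eq_square)
  have zy: "2 * y \<le> z" using yy xyz y3 by linarith
  \<comment> \<open>\<open>x \<le> y - 1\<close> and \<open>z \<ge> y^2 - 1\<close> yield the
    inequality that \<open>pos_pairI\<close> asks for.\<close>
  have "x * y \<le> (y - 1) * y" using xyz by (intro mult_right_mono) auto
  then have "x * y \<le> z" using xyz y3 by (simp add: algebra_simps power2_eq_square)
  then have "real_of_int x * real_of_int y \<le> real_of_int z" by (metis of_int_le_iff of_int_mult)
  moreover have "0 < tr2 (ev X Y w)" for w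
    using SL2_nonneg_trace[OF SL2_nonneg_phi[OF assms(1,2), of w]]
    by (simp add: X_def Y_def tr2_mat2_of flip: mat2_of_phi)
  ultimately have pos: "pos_pair X Y" using det tr by (intro pos_pairI) auto
  define x' y' z' where "x' = real_of_int x" and "y' = real_of_int y" and "z' = real_of_int z"
  have re: "2 \<le> x'" "x' < y'" "3 \<le> y'" "2 * y' \<le> z'"
    using xyz y3 zy unfolding x'_def y'_def z'_def by linarith+
  note tr = tr[folded x'_def y'_def z'_def] D[folded x'_def y'_def z'_def]
  obtain q where q1: "1 \<le> q" "q + 1 / q = z'" using ex_add_inverse_eq[of z'] re by auto
  moreover have "q \<noteq> 1" using q1 re by auto
  ultimately have q: "1 < q" "z' = q + 1 / q" by auto
  have "1 / q < 1" using q by simp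
  then have qy: "y' \<le> q" using q re by linarith
  have xz: "2 * y' \<le> x' * z'" "2 * x' \<le> y' * z'"
    using mult_mono[of 2 x' y' z'] mult_mono[of 2 y' x' z'] re by simp_all
  have xq: "y' \<le> x' * q" "x' \<le> y' * q"
    using mult_mono[of 1 x' y' q] mult_mono[of x' y' 1 q] re qy by simp_all
  show ?thesis unfolding C3 D2
  \<comment> \<open>In terms of \<open>x, y, z\<close> the cubed and squared traces are
    \<open>z^3 - 3z\<close> and \<open>(yz - x)^2 - 2\<close>; \<open>trace_gap\<close> turns either
    outcome into the hypotheses of a growth estimate.\<close>
  proof (intro conjI impI)
    assume "(y * z - x)\<^sup>2 - 2 < z ^ 3 - 3 * z"
    from trace_gap(1)[OF xyz this]
    have "real_of_int 0 \<le> real_of_int (z\<^sup>2 - 4 - y\<^sup>2 * z + 2 * x * y)" by (simp only: of_int_le_iff)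
    then have g: "0 \<le> z'\<^sup>2 - 4 - y'\<^sup>2 * z' + 2 * x' * y'" by (simp add: x'_def y'_def z'_def)
    show "complete_optimal A B {[GA, GB]}"
    proof (rule complete_optimalI, unfold X_def[symmetric] Y_def[symmetric])
      have "[GA, GB] = [] @ [GA] @ [GB] \<and> rotate 1 [GA, GB] = [] @ [GB] @ [GA]" by simp
      then have "lex_less [GA, GB] (rotate 1 [GA, GB])" unfolding lex_less_def by blast
      then show "lyndon [GA, GB]" by (auto simp: lyndon_def less_Suc_eq)
      show "rotation_of w (wpow [GA, GB] n)"
        if "length w = length [GA, GB] * n" "max_word X Y w" for n w
        by (rule max_word_ab[OF pos q(1)])
          (use that tr re xz xq growth_less_sqrt[OF re(1,2) g q] in \<open>simp_all flip: q(2)\<close>)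
    qed simp
  next
    assume "\<not> (y * z - x)\<^sup>2 - 2 < z ^ 3 - 3 * z"
    from trace_gap(2)[OF xyz this] have g: "z = y\<^sup>2 - 1" "2 * x \<le> y" by simp_all
    then have g': "z' = y'\<^sup>2 - 1" "2 * x' \<le> y'"
      unfolding x'_def y'_def z'_def by (simp, linarith)
    \<comment> \<open>\<open>d\<close> is the trace of \<open>X * Y * Y\<close>, \<open>r\<close>
      its larger eigenvalue, and the cube root \<open>e\<close> the growth of \<open>abb\<close> per
      letter.\<close>
    define d where "d = y' * z' - x'"
    have yz': "3 * z' \<le> y' * z'" using re by (intro mult_right_mono) auto
    have d: "2 \<le> d" "z' + 1 \<le> d" using re yz' unfolding d_def by linarith+
    obtain r where r1: "1 \<le> r" "r + 1 / r = d" using ex_add_inverse_eq[of d] d by auto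
    moreover have "r \<noteq> 1" using r1 d re by auto
    ultimately have r: "1 < r" "d = r + 1 / r" by auto
    have "1 / r < 1" using r by simp
    then have rz: "z' \<le> r" using r d by linarith
    define e where "e = root 3 r"
    have e: "0 < e" "e ^ 3 = r" using r by (simp_all add: e_def)
    have m: "y' \<le> z' * r" "2 * z' \<le> y' * d" "z' \<le> y' * r" "2 * y' \<le> z' * d"
      using mult_mono[of 1 z' y' r] mult_mono[of 2 y' z' d] mult_mono[of 1 y' z' r] mult_mono[of 2 z' y' d]
        re rz d by simp_all
    show "complete_optimal A B {[GA, GB, GB]}"
    proof (rule complete_optimalI, unfold X_def[symmetric] Y_def[symmetric])
      have "lex_less [GA, GB, GB] (rotate k [GA, GB, GB])" if "k = 1 \<or> k = 2" for k
      proof -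
        have "rotate k [GA, GB, GB] = [] @ [GB] @ tl (rotate k [GA, GB, GB])"
          using that by (auto simp: numeral_2_eq_2)
        moreover have "[GA, GB, GB] = [] @ [GA] @ [GB, GB]" by simp
        ultimately show ?thesis unfolding lex_less_def by blast
      qed
      then show "lyndon [GA, GB, GB]" by (auto simp: lyndon_def less_Suc_eq numeral_2_eq_2)
      show "rotation_of w (wpow [GA, GB, GB] n)"
        if "0 < n" "length w = length [GA, GB, GB] * n" "max_word X Y w" for n w
        by (rule max_word_abb[OF pos q(1) _ r(1) _ _ _ _ _ _ _ _ _ _ e])
          (use that tr re xz xq m d growth_less_root3[OF re(1) g'(2,1) q r[unfolded d_def] e]
            in \<open>simp_all add: d_def[symmetric] flip: q(2) r(2)\<close>)
    qed simp
  qed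
qed

end
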